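(* Let $w\in\mathrm{Gr}_{\mathcal H_+}(\mathcal H)$ and $\mathbf n\in\mathbf A$. The ring homomorphism $\mathcal S\to(S^\times_{\mathbf x})^{-1}\mathbb C[[\mathbf x,\mathbf t]]$ defined by $\pi_\lambda\mapsto H^{\mathbf n,\lambda}_w$ for all partitions $\lambda$ annihilates $\mathcal I$, and hence induces a homomorphism of commutative algebras $$\Phi^{\mathbf n}_w:\mathcal S/\mathcal I\to(S^\times_{\mathbf x})^{-1}\mathbb C[[\mathbf x,\mathbf t]],\qquad \pi_\lambda\mapsto H^{\mathbf n,\lambda}_w.$$
   Context: Partitions and Frobenius notation: a partition $\lambda$ of Frobenius rank $r$ is written $\lambda=(a_1,\dots,a_r\mid b_1,\dots,b_r)$ with $a_1>\dots>a_r\ge 0$, $b_1>\dots>b_r\ge 0$, $a_i=\lambda_i-i$, $b_i=\lambda'_i-i$ ($\lambda'$ the conjugate partition); $\emptyset$ denotes the empty partition (rank $0$). Let $\mathcal S=\mathbb C[\pi_\lambda]$ be the polynomial ring in countably many indeterminates $\pi_\lambda$ indexed by all partitions $\lambda$. Plücker relations: for integers $0<k<N$ and a $k$-tuple $L=(L_1,\dots,L_k)$ of integers in $\{-k,\dots,N-k-1\}$ set $\tilde\pi_L:=\mathrm{sgn}(L)\,\pi_{\lambda(L)}$, where $\mathrm{sgn}(L)$ is the sign of the permutation sorting $L$ into increasing order ($\mathrm{sgn}(L):=0$ if $L$ has a repeated entry) and, if $L'_1<\dots<L'_k$ is the increasing rearrangement of $L$, $\lambda(L)$ is the partition with parts $\lambda_i=L'_{k-i+1}+i$,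 $i=1,\dots,k$. For a $(k-1)$-tuple $I$ and a $(k+1)$-tuple $J$ with entries in $\{-k,\dots,N-k-1\}$ the Plücker quadratic form is $p_{I,J}:=\sum_{j=1}^{k+1}(-1)^j\tilde\pi_{I_1,\dots,I_{k-1},J_j}\,\tilde\pi_{J_1,\dots,\widehat{J_j},\dots,J_{k+1}}\in\mathcal S$ (hat = omission). $\mathcal I\subset\mathcal S$ is the ideal generated by all $p_{I,J}$ for all $0<k<N$ and all such $I,J$. Points and $\tau$-functions: a point $w\in\mathrm{Gr}_{\mathcal H_+}(\mathcal H)$ is a family $(\pi_\lambda(w))_\lambda$ of complex numbers, not all zero, such that every element of $\mathcal I$ vanishes when each $\pi_\lambda$ is replaced by $\pi_\lambda(w)$. Its KP $\tau$-function is $\tau_w(\mathbf t)=\sum_\lambda\pi_\lambda(w)s_\lambda(\mathbf t)\in\mathbb C[[\mathbf t]]$, $\mathbf t=(t_1,t_2,\dots)$, where $s_\lambda(\mathbf t)$ is the Schur function written as a polynomial in $t_i=p_i/i$ ($p_i$ the power sums). Let $\mathbb C[[\mathbf x,\mathbf t]]$ be the ring of formal power series in indeterminates $x_i$ ($i\in\mathbb Z$) and $t_j$ ($j\ge1$), graded by $\deg x_i=1,\deg t_j=j$, and $(S^\times_{\mathbf x})^{-1}\mathbb C[[\mathbf x,\mathbf t]]$ its localization at the multiplicative set generated by all $x_i-x_j$, $i\neq j$. For $f\in\mathbb C[[\mathbf t]]$ and integers $n_i$ (finitely many nonzero), $f(\mathbf t+\sum_i n_i[x_i])$ denotes the substitution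 $t_j\mapsto t_j+\sum_in_ix_i^j/j$. $\mathbf A$ is the group of integer sequences $\mathbf n=(n_i)_{i\in\mathbb Z}$ with finitely many nonzero entries; $\boldsymbol\alpha_i\in\mathbf A$ is the $i$-th unit vector. Define $H^{\mathbf n}_w:=\prod_{i<j}(x_i-x_j)^{n_in_j}\,\tau_w(\mathbf t+\sum_in_i[x_i])$ and, for $\lambda=(a_1,\dots,a_r\mid b_1,\dots,b_r)$, $H^{\mathbf n,\lambda}_w:=H_w^{\mathbf n+\sum_{i=1}^r\boldsymbol\alpha_{a_i}-\sum_{i=1}^r\boldsymbol\alpha_{-b_i-1}}$ (so $H^{\mathbf n,\emptyset}_w=H^{\mathbf n}_w$). *)

theory Defs
  imports Complex_Main "HOL-Library.Poly_Mapping" "HOL-Combinatorics.Permutations"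
    "HOL-Computational_Algebra.Formal_Power_Series" "HOL-Computational_Algebra.Fraction_Field"
begin

typedef partition = "{xs :: nat list. sorted_wrt (\<ge>) xs \<and> 0 \<notin> set xs}"
  by (rule exI[of _ "[]"]) simp

definition parts :: "partition \<Rightarrow> nat list" where
  "parts la = Rep_partition la"

definition psize :: "partition \<Rightarrow> nat" where
  "psize la = sum_list (parts la)"

definition part :: "partition \<Rightarrow> nat \<Rightarrow> nat" where
  "part la i = (if 1 \<le> i \<and> i \<le> length (parts la) then parts la ! (i - 1) else 0)"

definition conj_part :: "partition \<Rightarrow> nat \<Rightarrow> nat" where
  "conj_part la i = card {j. 1 \<le> j \<and> j \<le> length (parts la) \<and> i \<le> part la j}"

definition frob_rank :: "partition \<Rightarrow> nat" where
  "frob_rank la = card {i. 1 \<le> i \<and> i \<le> part la i}"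

definition frob_a :: "partition \<Rightarrow> nat \<Rightarrow> int" where
  "frob_a la i = int (part la i) - int i"

definition frob_b :: "partition \<Rightarrow> nat \<Rightarrow> int" where
  "frob_b la i = int (conj_part la i) - int i"

type_synonym spoly = "(partition \<Rightarrow>\<^sub>0 nat) \<Rightarrow>\<^sub>0 complex"

definition svar :: "partition \<Rightarrow> spoly" where
  "svar la = Poly_Mapping.single (Poly_Mapping.single la 1) 1"

definition seval :: "(complex \<Rightarrow> 'b::comm_ring_1) \<Rightarrow> (partition \<Rightarrow> 'b) \<Rightarrow> spoly \<Rightarrow> 'b" where
  "seval c phi p = (\<Sum>m\<in>Poly_Mapping.keys p. c (Poly_Mapping.lookup p m) * (\<Prod>la\<in>Poly_Mapping.keys (m :: partition \<Rightarrow>\<^sub>0 nat). phi la ^ Poly_Mapping.lookup m la))"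

definition sortsign :: "int list \<Rightarrow> int" where
  "sortsign L = (if distinct L
     then (-1) ^ card {(a, b). a < b \<and> b < length L \<and> L ! b < L ! a} else 0)"

definition lam_of :: "int list \<Rightarrow> partition" where
  "lam_of L = Abs_partition (let k = length L; L' = sort L in
      filter (\<lambda>x. x \<noteq> 0) (map (\<lambda>i. nat (L' ! (k - i) + int i)) [1..<k+1]))"

definition ptil :: "(partition \<Rightarrow> 'b::comm_ring_1) \<Rightarrow> int list \<Rightarrow> 'b" where
  "ptil phi L = of_int (sortsign L) * phi (lam_of L)"

definition pluecker_form :: "(partition \<Rightarrow> 'b::comm_ring_1) \<Rightarrow> int list \<Rightarrow> int list \<Rightarrow> 'b" where
  "pluecker_form phi I J =
     (\<Sum>j = 1..length J. (-1) ^ j * ptil phi (I @ [J ! (j - 1)]) * ptil phi (take (j - 1) J @ drop j J))"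

definition pluecker_gens :: "spoly set" where
  "pluecker_gens = {pluecker_form svar I J | I J (k::nat) (N::nat).
      0 < k \<and> k < N \<and> length I = k - 1 \<and> length J = k + 1 \<and>
      set I \<union> set J \<subseteq> {- int k .. int N - int k - 1}}"

inductive_set ideal_gen :: "'a::comm_ring_1 set \<Rightarrow> 'a set" for G where
  gen: "g \<in> G \<Longrightarrow> g \<in> ideal_gen G"
| zero: "0 \<in> ideal_gen G"
| add: "a \<in> ideal_gen G \<Longrightarrow> b \<in> ideal_gen G \<Longrightarrow> a + b \<in> ideal_gen G"
| mult: "a \<in> ideal_gen G \<Longrightarrow> r * a \<in> ideal_gen G"

definition pluecker_ideal :: "spoly set" where
  "pluecker_ideal = ideal_gen pluecker_gens"

definition is_grpoint :: "(partition \<Rightarrow> complex) \<Rightarrow> bool" where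
  "is_grpoint w \<longleftrightarrow> (\<exists>la. w la \<noteq> 0) \<and> (\<forall>q\<in>pluecker_ideal. seval id w q = 0)"

datatype var = X int | T nat

fun var_enc :: "var \<Rightarrow> int" where
  "var_enc (X i) = 2 * i"
| "var_enc (T j) = 2 * int j + 1"

lemma var_enc_inj: "var_enc a = var_enc b \<Longrightarrow> a = b"
  by (cases a; cases b) (auto; presburger)+

instantiation var :: linorder
begin
definition less_eq_var :: "var \<Rightarrow> var \<Rightarrow> bool" where "less_eq_var a b = (var_enc a \<le> var_enc b)"
definition less_var :: "var \<Rightarrow> var \<Rightarrow> bool" where "less_var a b = (var_enc a < var_enc b)"
instance
  by standard (auto simp: less_eq_var_def less_var_def intro: var_enc_inj)
end

text \<open>polynomials in the x_i (i in Z) and t_j (the variable T 0 is not used)\<close>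
type_synonym poly = "(var \<Rightarrow>\<^sub>0 nat) \<Rightarrow>\<^sub>0 complex"

text \<open>A graded power series sum_d f_d (f_d homogeneous of degree d) is represented as the
  formal power series sum_d f_d z^d over the polynomial ring.\<close>
type_synonym pser = "poly fps"

definition pconst :: "complex \<Rightarrow> poly" where
  "pconst c = Poly_Mapping.single 0 c"

definition pvar :: "var \<Rightarrow> poly" where
  "pvar v = Poly_Mapping.single (Poly_Mapping.single v 1) 1"

fun vweight :: "var \<Rightarrow> nat" where
  "vweight (X i) = 1"
| "vweight (T j) = j"

definition wdeg :: "(var \<Rightarrow>\<^sub>0 nat) \<Rightarrow> nat" where
  "wdeg mo = (\<Sum>v\<in>Poly_Mapping.keys mo. Poly_Mapping.lookup mo v * vweight v)"

definition Cxt :: "pser set" where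
  "Cxt = {F. \<forall>d. \<forall>mo\<in>Poly_Mapping.keys (fps_nth F d). wdeg mo = d \<and> Poly_Mapping.lookup mo (T 0) = 0}"

definition xdiff :: "int \<Rightarrow> int \<Rightarrow> pser" where
  "xdiff i j = fps_const (pvar (X i) - pvar (X j)) * fps_X"

inductive_set Smult :: "pser set" where
  one: "1 \<in> Smult"
| step: "i \<noteq> j \<Longrightarrow> s \<in> Smult \<Longrightarrow> xdiff i j * s \<in> Smult"

definition Loc :: "pser fract set" where
  "Loc = {Fract a s | a s. a \<in> Cxt \<and> s \<in> Smult}"

text \<open>h_k(t) = coefficient of z^k in exp(sum_j t_j z^j), with t_j replaced by u j\<close>
definition hcomp :: "(nat \<Rightarrow> poly) \<Rightarrow> int \<Rightarrow> poly" where
  "hcomp u k = (if k < 0 then 0 else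
     (\<Sum>m\<in>{m :: nat \<Rightarrow> nat. (\<forall>j. m j \<noteq> 0 \<longrightarrow> 1 \<le> j \<and> j \<le> nat k) \<and> (\<Sum>j = 1..nat k. j * m j) = nat k}.
        \<Prod>j = 1..nat k. pconst (1 / fact (m j)) * u j ^ m j))"

text \<open>Schur function s_lambda(t) (Jacobi-Trudi), with t_j replaced by u j\<close>
definition schur :: "(nat \<Rightarrow> poly) \<Rightarrow> partition \<Rightarrow> poly" where
  "schur u la = (let l = length (parts la) in
     \<Sum>\<sigma> | \<sigma> permutes {1..l}. of_int (sign \<sigma>) *
        (\<Prod>i = 1..l. hcomp u (int (part la i) - int i + int (\<sigma> i))))"

definition ushift :: "(int \<Rightarrow>\<^sub>0 int) \<Rightarrow> nat \<Rightarrow> poly" where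
  "ushift m j = pvar (T j) + (\<Sum>i\<in>Poly_Mapping.keys m. pconst (of_int (Poly_Mapping.lookup m i) / of_nat j) * pvar (X i) ^ j)"

definition tau_shift :: "(partition \<Rightarrow> complex) \<Rightarrow> (int \<Rightarrow>\<^sub>0 int) \<Rightarrow> pser" where
  "tau_shift w m = Abs_fps (\<lambda>d. \<Sum>la\<in>{la. psize la = d}. pconst (w la) * schur (ushift m) la)"

definition Hfun :: "(partition \<Rightarrow> complex) \<Rightarrow> (int \<Rightarrow>\<^sub>0 int) \<Rightarrow> pser fract" where
  "Hfun w m = (\<Prod>(i, j)\<in>{(i, j). i \<in> Poly_Mapping.keys m \<and> j \<in> Poly_Mapping.keys m \<and> i < j}.
                 Fract (xdiff i j) 1 powi (Poly_Mapping.lookup m i * Poly_Mapping.lookup m j)) * Fract (tau_shift w m) 1"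

definition frob_shift :: "partition \<Rightarrow> int \<Rightarrow>\<^sub>0 int" where
  "frob_shift la = (\<Sum>i = 1..frob_rank la.
      Poly_Mapping.single (frob_a la i) 1 - Poly_Mapping.single (- frob_b la i - 1) 1)"

definition Hfun_lam :: "(partition \<Rightarrow> complex) \<Rightarrow> (int \<Rightarrow>\<^sub>0 int) \<Rightarrow> partition \<Rightarrow> pser fract" where
  "Hfun_lam w n la = Hfun w (n + frob_shift la)"

definition Phi :: "(partition \<Rightarrow> complex) \<Rightarrow> (int \<Rightarrow>\<^sub>0 int) \<Rightarrow> spoly \<Rightarrow> pser fract" where
  "Phi w n = seval (\<lambda>c. Fract (fps_const (pconst c)) 1) (Hfun_lam w n)"

end

theory Submission
  imports Defs "HOL-Combinatorics.Multiset_Permutations"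
begin

text \<open>
  Index partitions by the sets \<open>{part la i - i}\<close>: passing from \<open>\<emptyset>\<close> to \<open>lam_of L\<close> removes the negative
  integers \<open>-k, \<dots>, -1\<close> and inserts the entries of \<open>L\<close>. Hence, with \<open>m\<close> the lattice point obtained from
  \<open>n\<close> by removing \<open>-k, \<dots>, -1\<close> and \<open>u = t + \<Sum>i. m i [x i]\<close>, the image of the signed coordinate of \<open>L\<close> is, up to
  factors which scale all terms of a quadratic relation equally, the product of the Vandermonde
  product of the \<open>x l\<close>, \<open>l \<in> L\<close>, with \<open>tau (u + \<Sum>l. [x l])\<close>.

  By Jacobi-Trudi, up to terms of high degree, \<open>tau u\<close> is the alternating \<open>M\<close>-linear form \<open>F\<close> with coefficients
  the Pluecker coordinates of \<open>w\<close>, evaluated at \<open>v_M(u), \<dots>, v_1(u)\<close> where \<open>v_j(u) = (h_{l+j}(u))_l\<close>. Since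
  \<open>v_j(u) = v_j(u + [x]) - x v_{j-1}(u + [x])\<close>, row operations turn the product above into
  \<open>\<plusminus>F(v_M(u), \<dots>, v_{k+1}(u), v_k(u + [x_1]), \<dots>, v_k(u + [x_k]))\<close>. The claim thus becomes the quadratic
  relation for \<open>F\<close> on arbitrary vectors, which by multilinearity is the one for \<open>w\<close>.
\<close>

section \<open>Evaluation homomorphisms\<close>

text \<open>\<open>tau\<close> is an infinite sum, while \<open>F\<close> has finitely many
  arguments. The bridge is the grading: a partition contributes to \<open>tau\<close> only in the
  degree equal to its size, and a partition of size at most \<open>M\<close> has at most
  \<open>M\<close> parts and all its indices in \<open>{- int M .. int M - 1}\<close>. Hence
  \<open>F\<close> with \<open>M\<close> arguments is exact up to degree \<open>M\<close>, and the
  identity is proved one coefficient at a time, with \<open>M\<close> depending on the coefficient.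

  The obstacle is that the relation to be proved exchanges entries of lists of length
  \<open>k\<close>, whereas \<open>F\<close> has \<open>M\<close> arguments. After the row
  operations each entry \<open>x\<close> of \<open>L\<close> occurs in one row only,
  \<open>v_k(u + [x])\<close>, and the other \<open>M - k\<close> rows are the same for every
  \<open>L\<close>. So the relation for \<open>F\<close> applies to lists of rows padded by the
  common ones: exchanging a common row repeats a row and gives zero, and the terms of the shorter
  relation remain.

  The Vandermonde product comes from the prefactor of \<open>H\<close>: the exponents n_i n_j are
  bilinear, and their part quadratic in the inserted unit vectors gives each difference of two
  entries of \<open>L\<close> once.\<close>

definition monom_eval :: "(partition \<Rightarrow> 'b::comm_ring_1) \<Rightarrow> (partition \<Rightarrow>\<^sub>0 nat) \<Rightarrow> 'b" where
  "monom_eval phi m = (\<Prod>la\<in>Poly_Mapping.keys m. phi la ^ Poly_Mapping.lookup m la)"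

lemma monom_eval_superset:
  assumes "finite A" "Poly_Mapping.keys m \<subseteq> A"
  shows "monom_eval phi m = (\<Prod>la\<in>A. phi la ^ Poly_Mapping.lookup m la)"
  unfolding monom_eval_def
  by (rule prod.mono_neutral_left) (use assms in \<open>auto simp: in_keys_iff\<close>)

lemma monom_eval_add: "monom_eval phi (m + m') = monom_eval phi m * monom_eval phi m'"
proof -
  let ?A = "Poly_Mapping.keys m \<union> Poly_Mapping.keys m'"
  have "Poly_Mapping.keys (m + m') \<subseteq> ?A" by (rule keys_add)
  then show ?thesis
    by (simp add: monom_eval_superset[of ?A] lookup_add power_add prod.distrib)
qed

lemma poly_mapping_single_induct [case_names zero add]:
  fixes p :: "'a \<Rightarrow>\<^sub>0 'b::comm_monoid_add"
  assumes "P 0" and "\<And>m c p. P p \<Longrightarrow> P (Poly_Mapping.single m c + p)"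
  shows "P p"
proof (induction p rule: update_induct)
  case const then show ?case by (rule assms(1))
next
  case (update f a b)
  have "Poly_Mapping.update a b f = Poly_Mapping.single a b + f"
    using update(1) by (intro poly_mapping_eqI) (auto simp: lookup_update lookup_add lookup_single when_def in_keys_iff)
  then show ?case using assms(2) update by simp
qed

text \<open>Shared by three evaluations: \<open>id\<close> for the values at \<open>w\<close>,
  \<open>fconst\<close> for the coefficients of the alternating form, and the constants of
  \<open>pser fract\<close> for \<open>Phi\<close>.\<close>

locale coeff_hom =
  fixes c :: "complex \<Rightarrow> 'b::comm_ring_1"
  assumes c0: "c 0 = 0" and c1: "c 1 = 1"
    and c_add: "\<And>a b. c (a + b) = c a + c b"
    and c_mult: "\<And>a b. c (a * b) = c a * c b"
begin

lemma seval_superset: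
  assumes "finite A" "Poly_Mapping.keys p \<subseteq> A"
  shows "seval c phi p = (\<Sum>m\<in>A. c (Poly_Mapping.lookup p m) * monom_eval phi m)"
  unfolding seval_def monom_eval_def[symmetric]
  by (rule sum.mono_neutral_left) (use assms in \<open>auto simp: in_keys_iff c0\<close>)

lemma seval_add: "seval c phi (p + q) = seval c phi p + seval c phi q"
proof -
  let ?A = "Poly_Mapping.keys p \<union> Poly_Mapping.keys q"
  have "Poly_Mapping.keys (p + q) \<subseteq> ?A" by (rule keys_add)
  then show ?thesis
    by (simp add: seval_superset[of ?A] lookup_add c_add distrib_right sum.distrib)
qed

lemma seval_zero: "seval c phi 0 = 0"
  by (simp add: seval_def)

lemma seval_single: "seval c phi (Poly_Mapping.single m a) = c a * monom_eval phi m"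
  by (cases "a = 0") (simp_all add: seval_def monom_eval_def c0)

lemma seval_one: "seval c phi 1 = 1"
  using seval_single[of phi 0 1] by (simp add: c1 monom_eval_def)

lemma seval_mult: "seval c phi (p * q) = seval c phi p * seval c phi q"
proof -
  have *: "seval c phi (Poly_Mapping.single m a * q) = seval c phi (Poly_Mapping.single m a) * seval c phi q" for m a
    by (induction q rule: poly_mapping_single_induct)
      (simp_all add: seval_zero seval_add distrib_left mult_single seval_single c_mult monom_eval_add mult_ac)
  show ?thesis
    by (induction p rule: poly_mapping_single_induct)
      (simp_all add: seval_zero seval_add distrib_right *)
qed

lemma seval_svar: "seval c phi (svar la) = phi la"
  by (simp add: svar_def seval_single c1 monom_eval_def)

lemma seval_uminus: "seval c phi (- p) = - seval c phi p"
  using seval_add[of phi p "- p"] by (simp add: seval_zero eq_neg_iff_add_eq_0 add.commute)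

lemma seval_of_int: "seval c phi (of_int k) = of_int k"
proof -
  have "seval c phi (of_nat n) = of_nat n" for n
    by (induction n) (simp_all add: seval_zero seval_one seval_add)
  then show ?thesis
    by (cases k rule: int_cases2) (simp_all add: seval_uminus)
qed

lemma seval_sum: "seval c phi (sum f A) = (\<Sum>i\<in>A. seval c phi (f i))"
  by (induction A rule: infinite_finite_induct) (simp_all add: seval_zero seval_add)

lemma seval_sign: "seval c phi ((- 1) ^ j) = (- 1) ^ j"
  by (induction j) (simp_all add: seval_one seval_uminus)

text \<open>\<open>pluecker_form\<close> is polymorphic in the values \<open>phi\<close>, so the
  generic relation and its specializations are instances of one expression, and vanishing on a
  generator becomes an identity between the values \<open>phi la\<close>.\<close>

lemma seval_pluecker_form:
  "seval c phi (pluecker_form svar I J) = pluecker_form phi I J"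
  unfolding pluecker_form_def ptil_def
  by (simp add: seval_sum seval_mult seval_sign seval_of_int seval_svar)

end

lemma is_grpoint_pluecker:
  assumes "is_grpoint w" "0 < k" "k < N" "length I = k - 1" "length J = k + 1"
    "set I \<union> set J \<subseteq> {- int k .. int N - int k - 1}"
  shows "pluecker_form w I J = 0"
proof -
  interpret coeff_hom "id :: complex \<Rightarrow> complex" by unfold_locales auto
  have "pluecker_form svar I J \<in> pluecker_ideal"
    unfolding pluecker_ideal_def pluecker_gens_def using assms(2-)
    by (intro ideal_gen.gen) blast
  then show ?thesis
    using assms(1) seval_pluecker_form unfolding is_grpoint_def by metis
qed

section \<open>Constants of the polynomial ring\<close>

lemma pconst_zero [simp]: "pconst 0 = 0" and pconst_one [simp]: "pconst 1 = 1"
  and pconst_add: "pconst (a + b) = pconst a + pconst b"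
  and pconst_mult: "pconst (a * b) = pconst a * pconst b"
  by (simp_all add: pconst_def single_add mult_single)

lemma pconst_uminus: "pconst (- a) = - pconst a"
  using pconst_add[of a "- a"] by (simp add: eq_neg_iff_add_eq_0 add.commute)

lemma pconst_of_int: "pconst (of_int k) = of_int k"
proof -
  have "pconst (of_nat n) = of_nat n" for n
    by (induction n) (simp_all add: pconst_add)
  then show ?thesis
    by (cases k rule: int_cases2) (simp_all add: pconst_uminus)
qed

lemma of_nat_mult_pconst: "of_nat k * pconst c = pconst (of_nat k * c)"
  using pconst_of_int[of "int k"] by (simp add: pconst_mult)

section \<open>Signs and products over pairs\<close>

text \<open>With differences as factors this is a Vandermonde product. The factors follow the order
  of the list, not of its entries, so that reordering the list shows up as a sign.\<close>

primrec pairprod :: "('a \<Rightarrow> 'a \<Rightarrow> 'b::comm_ring_1) \<Rightarrow> 'a list \<Rightarrow> 'b" where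
  "pairprod f [] = 1"
| "pairprod f (x # xs) = prod_list (map (f x) xs) * pairprod f xs"

lemma prod_list_mult: "prod_list (map (\<lambda>x. f x * g x) xs) = prod_list (map f xs) * (prod_list (map g xs) :: 'b::comm_ring_1)"
  by (induction xs) (simp_all add: mult_ac)

lemma pairprod_mult: "pairprod f xs * pairprod g xs = pairprod (\<lambda>x y. f x y * g x y) xs"
proof (induction xs)
  case (Cons a xs)
  then show ?case by (simp add: prod_list_mult mult_ac flip: Cons)
qed simp

lemma pairprod_snoc: "pairprod f (xs @ [x]) = pairprod f xs * prod_list (map (\<lambda>y. f y x) xs)"
  by (induction xs) (simp_all add: mult_ac)

lemma prod_list_rev: "prod_list (rev xs) = (prod_list xs :: 'b::comm_monoid_mult)"
  by (induction xs) (simp_all add: mult_ac)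

lemma pairprod_rev: "pairprod f (rev xs) = pairprod (\<lambda>x y. f y x) xs"
  by (induction xs) (simp_all add: pairprod_snoc mult_ac prod_list_rev flip: rev_map)

lemma pairprod_eq_0:
  assumes "\<And>x. f x x = 0" "\<not> distinct xs"
  shows "pairprod f xs = 0"
  using assms(2)
proof (induction xs)
  case (Cons a xs)
  then show ?case
  proof (cases "a \<in> set xs")
    case True
    then obtain ys zs where "xs = ys @ a # zs" by (auto simp: in_set_conv_decomp)
    then show ?thesis by (simp add: assms(1))
  qed simp
qed simp

text \<open>Moving \<open>x\<close> to the front reverses its order with each entry of
  \<open>xs\<close>, at the cost of one factor \<open>e\<close> each; \<open>e = -1\<close> serves
  antisymmetric and \<open>e = 1\<close> symmetric factors.\<close>

lemma pairprod_append_Cons: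
  fixes f :: "'a \<Rightarrow> 'a \<Rightarrow> 'b::comm_ring_1"
  assumes "\<And>x y. f x y = e * f y x"
  shows "pairprod f (xs @ x # ys) = e ^ length xs * pairprod f (x # xs @ ys)"
proof (induction xs)
  case (Cons a xs)
  show ?case using Cons assms[of a x] by (simp add: mult_ac)
qed simp

lemma pairprod_swap:
  fixes f :: "'a \<Rightarrow> 'a \<Rightarrow> 'b::comm_ring_1"
  assumes anti: "\<And>x y. f x y = - f y x"
  shows "pairprod f (xs @ a # ys @ b # zs) = - pairprod f (xs @ b # ys @ a # zs)"
proof -
  have e: "f x y = (-1) * f y x" for x y using anti[of x y] by simp
  note move = pairprod_append_Cons[of f "-1", OF e]
  let ?l = "\<lambda>xs. (-1) ^ length xs :: 'b"
  have "pairprod f (xs @ a # ys @ b # zs) = pairprod f ((xs @ a # ys) @ b # zs)" by simp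
  also have "\<dots> = - (?l xs * ?l ys * (prod_list (map (f b) (xs @ a # ys @ zs)) * (?l xs * pairprod f (a # xs @ ys @ zs))))"
    unfolding move[of "xs @ a # ys"] using move[of xs a "ys @ zs"] by (simp add: power_add)
  also have "\<dots> = - (?l xs * (prod_list (map (f b) (xs @ ys @ a # zs)) * (?l (xs @ ys) * pairprod f (a # (xs @ ys) @ zs))))"
    by (simp add: power_add mult_ac)
  also have "\<dots> = - pairprod f (xs @ b # ys @ a # zs)"
    unfolding move[of xs] move[of "xs @ ys" a zs, symmetric] by simp
  finally show ?thesis .
qed

lemma pairprod_mset:
  fixes f :: "'a \<Rightarrow> 'a \<Rightarrow> 'b::comm_ring_1"
  assumes sym: "\<And>x y. f x y = f y x" and "mset xs = mset ys"
  shows "pairprod f xs = pairprod f ys"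
  using assms(2)
proof (induction xs arbitrary: ys)
  case (Cons x xs)
  have "x \<in> set ys" using Cons.prems by (metis list.set_intros(1) set_mset_mset)
  then obtain us vs where ys: "ys = us @ x # vs" by (auto simp: in_set_conv_decomp)
  have m: "mset xs = mset (us @ vs)" using Cons.prems ys by simp
  have "pairprod f ys = pairprod f (x # us @ vs)"
    unfolding ys using pairprod_append_Cons[of f 1 us x vs] sym by simp
  moreover have "prod_list (map (f x) xs) = prod_list (map (f x) (us @ vs))"
    using arg_cong[OF m, of "\<lambda>M. prod_mset (image_mset (f x) M)"]
    by (simp only: mset_map[symmetric] prod_mset_prod_list)
  ultimately show ?case using Cons.IH[OF m] by simp
qed simp

text \<open>A permutation is a product of transpositions, and each transposition exchanges two
  positions as in \<open>pairprod_swap\<close>.\<close>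

lemma pairprod_permutes:
  fixes f :: "'a \<Rightarrow> 'a \<Rightarrow> 'b::comm_ring_1"
  assumes anti: "\<And>x y. f x y = - f y x" and "\<sigma> permutes {1..M}"
  shows "pairprod f (map (\<lambda>i. e (\<sigma> i)) [1..<Suc M]) = of_int (sign \<sigma>) * pairprod f (map e [1..<Suc M])"
proof -
  have transp: "pairprod f (map (\<lambda>i. e (Transposition.transpose a b i)) [1..<Suc M]) = - pairprod f (map e [1..<Suc M])"
    if "1 \<le> a" "a < b" "b \<le> M" for a b and e :: "nat \<Rightarrow> 'a"
  proof -
    have split: "[1..<Suc M] = [1..<a] @ a # [Suc a..<b] @ b # [Suc b..<Suc M]"
      using that by (smt (verit) One_nat_def Suc_leI append_Cons le_SucI less_imp_le_nat nat_less_le not_less_eq_eq upt_add_eq_append upt_conv_Cons le_add_diff_inverse linorder_not_less order.trans)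
    have "map (\<lambda>i. e (Transposition.transpose a b i)) [1..<a] = map e [1..<a]"
      "map (\<lambda>i. e (Transposition.transpose a b i)) [Suc a..<b] = map e [Suc a..<b]"
      "map (\<lambda>i. e (Transposition.transpose a b i)) [Suc b..<Suc M] = map e [Suc b..<Suc M]"
      using that by (auto simp: transpose_def)
    then show ?thesis
      unfolding split map_append list.map
      by (simp only: transpose_apply_first transpose_apply_second pairprod_swap[of f "map e [1..<a]" "e b", OF anti])
  qed
  show ?thesis
    using assms(2) finite_atLeastAtMost[of 1 M]
  proof (induction \<sigma> arbitrary: e rule: permutes_induct)
    case id
    then show ?case by simp
  next
    case (swap a b p)
    have "pairprod f (map (\<lambda>i. e (Transposition.transpose a b i)) [1..<Suc M]) = - pairprod f (map e [1..<Suc M])"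
    proof (cases "a < b")
      case True
      then show ?thesis using swap by (intro transp) auto
    next
      case False
      then show ?thesis using swap transp[of b a e] by (auto simp: transpose_commute[of a b])
    qed
    moreover have "sign (Transposition.transpose a b \<circ> p) = - sign p"
      using swap by (subst sign_compose) (auto simp: sign_swap_id permutation_swap_id intro: permutation_permutes[THEN iffD2])
    ultimately show ?case using swap.IH[of "e \<circ> Transposition.transpose a b"] by (simp add: o_def)
  qed
qed

text \<open>A pair contributes -1 exactly when it is an inversion, and a repeated entry contributes
  the factor 0, in accordance with the convention for repetitions. Signs can thus be treated like
  Vandermonde products.\<close>

lemma sortsign_pairprod: "sortsign L = pairprod (\<lambda>a b. sgn (b - a)) L"
proof (cases "distinct L")
  case False
  then show ?thesis by (simp add: sortsign_def pairprod_eq_0)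
next
  case True
  define inv where "inv L = {(a, b). a < b \<and> b < length L \<and> L ! b < L ! a}" for L :: "int list"
  have fin: "finite (inv L)" for L
    by (rule finite_subset[of _ "{..length L} \<times> {..length L}"]) (auto simp: inv_def)
  have card_Cons: "card (inv (x # xs)) = card {b. b < length xs \<and> xs ! b < x} + card (inv xs)" for x xs
  proof -
    have "inv (x # xs) = (\<lambda>b. (0, Suc b)) ` {b. b < length xs \<and> xs ! b < x} \<union> map_prod Suc Suc ` inv xs"
    proof (intro set_eqI)
      fix p :: "nat \<times> nat"
      show "p \<in> inv (x # xs) \<longleftrightarrow> p \<in> (\<lambda>b. (0, Suc b)) ` {b. b < length xs \<and> xs ! b < x} \<union> map_prod Suc Suc ` inv xs"
        by (cases p; cases "fst p"; cases "snd p") (auto simp: inv_def image_iff)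
    qed
    moreover have "card (\<dots>) = card {b. b < length xs \<and> xs ! b < x} + card (inv xs)"
      by (subst card_Un_disjoint) (auto simp: fin card_image inj_on_def intro!: card_image)
    ultimately show ?thesis by simp
  qed
  have count: "(-1) ^ card {b. b < length xs \<and> xs ! b < x} = prod_list (map (\<lambda>b. sgn (b - x)) xs)"
    if "x \<notin> set xs" for x :: int and xs
    using that
  proof (induction xs)
    case (Cons y ys)
    have "{b. b < length (y # ys) \<and> (y # ys) ! b < x} =
      (if y < x then {0} else {}) \<union> Suc ` {b. b < length ys \<and> ys ! b < x}"
    proof (intro set_eqI)
      fix b
      show "b \<in> {b. b < length (y # ys) \<and> (y # ys) ! b < x} \<longleftrightarrow>
        b \<in> (if y < x then {0} else {}) \<union> Suc ` {b. b < length ys \<and> ys ! b < x}"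
        by (cases b) auto
    qed
    then have "card {b. b < length (y # ys) \<and> (y # ys) ! b < x} =
      (if y < x then 1 else 0) + card {b. b < length ys \<and> ys ! b < x}"
      by (auto simp: card_image card_insert_if)
    then show ?case using Cons by auto
  qed simp
  have "distinct L \<Longrightarrow> (-1) ^ card (inv L) = pairprod (\<lambda>a b. sgn (b - a)) L" for L
  proof (induction L)
    case (Cons x xs)
    then show ?case by (simp add: card_Cons power_add count)
  qed (simp add: inv_def)
  then show ?thesis using True by (simp add: sortsign_def inv_def)
qed

lemma sortsign_sorted: "sorted L \<Longrightarrow> distinct L \<Longrightarrow> sortsign L = 1"
proof -
  assume "sorted L" "distinct L"
  then have "\<not> L ! b < L ! a" if "a < b" "b < length L" for a b
    using that sorted_nth_mono[of L a b] by simp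
  then have "{(a, b). a < b \<and> b < length L \<and> L ! b < L ! a} = {}" by blast
  then show ?thesis using \<open>distinct L\<close> by (simp only: sortsign_def) simp
qed

lemma sortsign_mult_self: "distinct L \<Longrightarrow> sortsign L * sortsign L = 1"
  by (simp add: sortsign_def flip: power_add)

text \<open>The sign and \<open>f\<close> are both antisymmetric, so their product is symmetric and
  insensitive to sorting; on the sorted list the sign is 1, and the sign squares to 1.\<close>

lemma sortsign_mult_pairprod_sort:
  fixes f :: "int \<Rightarrow> int \<Rightarrow> 'b::comm_ring_1"
  assumes anti: "\<And>x y. f x y = - f y x" and "distinct L"
  shows "of_int (sortsign L) * pairprod f (sort L) = pairprod f L"
proof -
  have hl: "of_int (prod_list xs) = (prod_list (map of_int xs) :: 'b)" for xs
    by (induction xs) simp_all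
  have hom: "of_int (pairprod g L) = pairprod (\<lambda>a b. of_int (g a b) :: 'b) L" for g :: "int \<Rightarrow> int \<Rightarrow> int" and L
    by (induction L) (simp_all add: hl o_def)
  let ?s = "\<lambda>a b. of_int (sgn (b - a)) :: 'b"
  have "?s x y * f x y = ?s y x * f y x" for x y
    using anti[of x y] by (cases x y rule: linorder_cases) auto
  then have "pairprod (\<lambda>x y. ?s x y * f x y) L = pairprod (\<lambda>x y. ?s x y * f x y) (sort L)"
    by (intro pairprod_mset) auto
  then have "of_int (sortsign L) * pairprod f L = of_int (sortsign (sort L)) * pairprod f (sort L)"
    by (simp add: sortsign_pairprod hom pairprod_mult)
  then have *: "of_int (sortsign L) * pairprod f L = pairprod f (sort L)"
    using assms(2) by (simp add: sortsign_sorted)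
  show ?thesis unfolding *[symmetric] mult.assoc[symmetric] 
    using sortsign_mult_self[OF assms(2)] by (simp flip: of_int_mult)
qed

lemma sortsign_swap: "sortsign (xs @ a # ys @ b # zs) = - sortsign (xs @ b # ys @ a # zs)"
  unfolding sortsign_pairprod by (rule pairprod_swap) (simp add: sgn_if)

section \<open>Signed Pluecker coordinates under exchange of entries\<close>

lemma lam_of_mset: "mset L = mset L' \<Longrightarrow> lam_of L = lam_of L'"
proof -
  assume m: "mset L = mset L'"
  then have "sort L = sort L'" by (metis sorted_list_of_multiset_mset)
  moreover have "length L = length L'" by (rule mset_eq_length[OF m])
  ultimately show ?thesis unfolding lam_of_def by simp
qed

lemma list_split_two:
  assumes "i < j" "j < length L"
  obtains xs ys zs where "L = xs @ L ! i # ys @ L ! j # zs" "length xs = i" "length ys = j - i - 1"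
proof
  let ?xs = "take i L" and ?ys = "take (j - i - 1) (drop (Suc i) L)" and ?zs = "drop (Suc j) L"
  have "L = take i L @ L ! i # drop (Suc i) L" using assms by (simp add: id_take_nth_drop)
  moreover have "drop (Suc i) L = ?ys @ L ! j # ?zs"
    using id_take_nth_drop[of "j - i - 1" "drop (Suc i) L"] assms by simp
  ultimately show "L = ?xs @ L ! i # ?ys @ L ! j # ?zs" by simp
qed (use assms in auto)

lemma ptil_swap:
  assumes "i < length L" "j < length L" "i \<noteq> j"
  shows "ptil phi (L[i := L ! j, j := L ! i]) = - ptil phi L"
proof -
  have main: "ptil phi (L[i := L ! j, j := L ! i]) = - ptil phi L" if "i < j" "j < length L" for i j
  proof -
    obtain xs ys zs where L: "L = xs @ L ! i # ys @ L ! j # zs" and len: "length xs = i" "length ys = j - i - 1"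
      using list_split_two[OF \<open>i < j\<close> \<open>j < length L\<close>] by blast
    define a b where "a = L ! i" and "b = L ! j"
    have L: "L = xs @ a # ys @ b # zs" using L by (simp add: a_def b_def)
    have "L[i := b, j := a] = xs @ b # ys @ a # zs"
    proof -
      have j: "j = length (xs @ b # ys)" using len that by simp
      have "L[i := b] = (xs @ b # ys) @ b # zs" unfolding L len(1)[symmetric] by simp
      then show ?thesis unfolding j by (simp only: list_update_length) simp
    qed
    moreover have "lam_of (xs @ b # ys @ a # zs) = lam_of L"
      unfolding L by (rule lam_of_mset) simp
    ultimately show ?thesis
      unfolding a_def[symmetric] b_def[symmetric]
      using sortsign_swap[of xs b ys a zs] by (simp add: ptil_def L)
  qed
  show ?thesis
  proof (cases "i < j")
    case True then show ?thesis using main assms by simp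
  next
    case False
    then show ?thesis using main[of j i] assms by (simp add: list_update_swap)
  qed
qed

section \<open>Complete symmetric functions\<close>

text \<open>The bound \<open>K\<close> on the indices is kept apart from the weight
  \<open>n\<close>, so that \<open>hcomp\<close> at different weights can be expanded over the same
  variables.\<close>

definition weighted :: "nat \<Rightarrow> nat \<Rightarrow> (nat \<Rightarrow> nat) set" where
  "weighted K n = {m. (\<forall>j. m j \<noteq> 0 \<longrightarrow> 1 \<le> j \<and> j \<le> K) \<and> (\<Sum>j = 1..K. j * m j) = n}"

definition exp_term :: "(nat \<Rightarrow> poly) \<Rightarrow> nat \<Rightarrow> (nat \<Rightarrow> nat) \<Rightarrow> poly" where
  "exp_term u K m = (\<Prod>j = 1..K. pconst (1 / fact (m j)) * u j ^ m j)"

lemma weighted_bound: "m \<in> weighted K n \<Longrightarrow> j \<in> {1..K} \<Longrightarrow> j * m j \<le> n"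
  unfolding weighted_def using member_le_sum[of j "{1..K}" "\<lambda>j. j * m j"] by auto

lemma finite_weighted: "finite (weighted K n)"
proof (rule finite_subset)
  show "weighted K n \<subseteq> {m. \<forall>j. (j \<in> {1..K} \<longrightarrow> m j \<in> {..n}) \<and> (j \<notin> {1..K} \<longrightarrow> m j = 0)}"
  proof (intro subsetI CollectI allI conjI impI)
    fix m j assume m: "m \<in> weighted K n"
    show "m j = 0" if "j \<notin> {1..K}" using m that by (auto simp: weighted_def)
    show "m j \<in> {..n}" if "j \<in> {1..K}"
      using weighted_bound[OF m that] that by (cases j) auto
  qed
qed (rule finite_set_of_finite_funs; simp)

text \<open>An index \<open>j > n\<close> would already exceed the weight, so enlarging the bound
  adds no exponent vectors and only factors 1.\<close>

lemma hcomp_weighted: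
  assumes "n \<le> K"
  shows "hcomp u (int n) = (\<Sum>m\<in>weighted K n. exp_term u K m)"
proof -
  have sub: "m j = 0" if "m \<in> weighted K n" "n < j" for m j
  proof (cases "j \<in> {1..K}")
    case True
    then have "j * m j \<le> n" using weighted_bound that by blast
    then show ?thesis using that by (cases "m j") auto
  qed (use that in \<open>auto simp: weighted_def\<close>)
  have ext: "(\<Sum>j = 1..K. j * m j) = (\<Sum>j = 1..n. j * m j)" if "\<And>j. n < j \<Longrightarrow> m j = 0" for m :: "nat \<Rightarrow> nat"
    using assms that by (intro sum.mono_neutral_right) auto
  have "m \<in> weighted K n \<longleftrightarrow> m \<in> weighted n n" for m
  proof
    assume m: "m \<in> weighted K n"
    show "m \<in> weighted n n"
    proof -
      have "j \<le> n" if "m j \<noteq> 0" for j using sub[OF m, of j] that by (cases "n < j") auto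
      moreover have "(\<Sum>j = 1..n. j * m j) = n"
      proof -
        have "(\<Sum>j = 1..K. j * m j) = (\<Sum>j = 1..n. j * m j)" by (rule ext) (rule sub[OF m])
        then show ?thesis using m unfolding weighted_def by simp
      qed
      ultimately show ?thesis using m unfolding weighted_def by blast
    qed
  next
    assume m: "m \<in> weighted n n"
    then have z: "m j = 0" if "n < j" for j using that unfolding weighted_def by (auto simp: not_le)
    have "(\<Sum>j = 1..K. j * m j) = n"
    proof -
      have "(\<Sum>j = 1..K. j * m j) = (\<Sum>j = 1..n. j * m j)" by (rule ext) (rule z)
      then show ?thesis using m unfolding weighted_def by simp
    qed
    then show "m \<in> weighted K n"
      using m assms unfolding weighted_def by (blast intro: le_trans)
  qed
  then have eq: "weighted K n = weighted n n" by blast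
  have "exp_term u K m = exp_term u n m" if "m \<in> weighted n n" for m
    unfolding exp_term_def using assms sub[of m] that eq
    by (intro prod.mono_neutral_right) auto
  then show ?thesis unfolding eq by (simp add: hcomp_def weighted_def exp_term_def)
qed

lemma hcomp_neg [simp]: "k < 0 \<Longrightarrow> hcomp u k = 0"
  by (simp add: hcomp_def)

lemma hcomp_0 [simp]: "hcomp u 0 = 1"
proof -
  have "weighted 0 0 = {\<lambda>_. 0}" by (auto simp: weighted_def fun_eq_iff)
  then show ?thesis using hcomp_weighted[of 0 0 u] by (simp add: exp_term_def)
qed

lemma of_nat_cancel_poly:
  assumes "of_nat (Suc n) * a = of_nat (Suc n) * (b :: poly)"
  shows "a = b"
proof -
  have "pconst (1 / of_nat (Suc n)) * of_nat (Suc n) = 1"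
    using of_nat_mult_pconst[of "Suc n" "1 / of_nat (Suc n)"] of_nat_neq_0[of n, where ?'a=complex]
    by (simp del: of_nat_Suc add: mult.commute)
  then show ?thesis
    using arg_cong[OF assms, of "(*) (pconst (1 / of_nat (Suc n)))"]
    by (simp only: mult.assoc[symmetric] mult_1)
qed

text \<open>Newton's identity, the coefficient form of \<open>z H'(z) = U(z) H(z)\<close> for
  \<open>H\<close> the exponential series of the \<open>u j\<close> and \<open>U\<close> the series
  of the \<open>j * u j\<close>. It comes from replacing the factor \<open>n\<close> in each term by
  its weight and lowering one exponent.\<close>

lemma hcomp_recurrence:
  "of_nat n * hcomp u (int n) = (\<Sum>j = 1..n. of_nat j * u j * hcomp u (int (n - j)))"
proof -
  let ?P = "exp_term u n"
  have step: "(\<Sum>m\<in>weighted n n. of_nat (j * m j) * ?P m) = of_nat j * u j * hcomp u (int (n - j))"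
    if j: "j \<in> {1..n}" for j
  proof -
    let ?up = "\<lambda>m. m(j := Suc (m j))"
    have weight_up: "(\<Sum>i = 1..n. i * ?up m i) = j + (\<Sum>i = 1..n. i * m i)" for m
      using j by (subst (1 2) sum.remove[of _ j]) (auto intro!: sum.cong)
    \<comment> \<open>The new factor \<open>Suc (m j)\<close> cancels against the factorial, as in
      differentiating a divided power.\<close>
    have P_up: "of_nat (Suc (m j)) * ?P (?up m) = u j * ?P m" for m
    proof -
      have c: "of_nat (Suc (m j)) * pconst (1 / fact (Suc (m j))) = pconst (1 / fact (m j))"
        unfolding of_nat_mult_pconst
        using of_nat_neq_0[of "m j", where ?'a=complex] by (simp del: of_nat_Suc)
      have "?P (?up m) = pconst (1 / fact (Suc (m j))) * u j ^ Suc (m j) *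
          (\<Prod>i\<in>{1..n} - {j}. pconst (1 / fact (m i)) * u i ^ m i)"
        unfolding exp_term_def using j by (subst prod.remove[of _ j]) (auto intro!: prod.cong)
      then have "of_nat (Suc (m j)) * ?P (?up m) = u j * (pconst (1 / fact (m j)) * u j ^ m j *
          (\<Prod>i\<in>{1..n} - {j}. pconst (1 / fact (m i)) * u i ^ m i))"
        unfolding c[symmetric] by (simp only: power_Suc mult_ac)
      also have "\<dots> = u j * ?P m"
        unfolding exp_term_def using j by (subst (2) prod.remove[of _ j]) auto
      finally show ?thesis .
    qed
    \<comment> \<open>Terms with \<open>m j = 0\<close> carry the factor 0; on the others, lowering
      \<open>m j\<close> by one is a bijection onto weight \<open>n - j\<close>.\<close>
    have "(\<Sum>m\<in>weighted n n. of_nat (j * m j) * ?P m) =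
        (\<Sum>m\<in>{m \<in> weighted n n. m j \<noteq> 0}. of_nat (j * m j) * ?P m)"
      by (intro sum.mono_neutral_right) (auto simp: finite_weighted)
    also have "\<dots> = (\<Sum>m\<in>weighted n (n - j). of_nat (j * Suc (m j)) * ?P (?up m))"
    proof (rule sum.reindex_bij_witness[of _ ?up "\<lambda>m. m(j := m j - 1)"])
      fix m assume "m \<in> {m \<in> weighted n n. m j \<noteq> 0}"
      moreover from this have "?up (m(j := m j - 1)) = m" by auto
      ultimately show "m(j := m j - 1) \<in> weighted n (n - j)"
        using weight_up[of "m(j := m j - 1)"] j unfolding weighted_def by auto
    next
      fix m assume "m \<in> weighted n (n - j)"
      then show "?up m \<in> {m \<in> weighted n n. m j \<noteq> 0}"
        using weight_up[of m] j unfolding weighted_def by auto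
    qed auto
    also have "\<dots> = (\<Sum>m\<in>weighted n (n - j). of_nat j * u j * ?P m)"
      by (intro sum.cong refl) (simp only: of_nat_mult P_up mult.assoc)
    also have "\<dots> = of_nat j * u j * hcomp u (int (n - j))"
      by (subst hcomp_weighted[of "n - j" n]) (auto simp: sum_distrib_left)
    finally show ?thesis .
  qed
  have "of_nat n * hcomp u (int n) = (\<Sum>m\<in>weighted n n. of_nat n * ?P m)"
    by (simp add: hcomp_weighted[of n n] sum_distrib_left)
  also have "\<dots> = (\<Sum>m\<in>weighted n n. \<Sum>j = 1..n. of_nat (j * m j) * ?P m)"
    unfolding sum_distrib_right[symmetric] of_nat_sum[symmetric]
    by (intro sum.cong refl) (simp add: weighted_def)
  also have "\<dots> = (\<Sum>j = 1..n. \<Sum>m\<in>weighted n n. of_nat (j * m j) * ?P m)"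
    by (rule sum.swap)
  also have "\<dots> = (\<Sum>j = 1..n. of_nat j * u j * hcomp u (int (n - j)))"
    by (intro sum.cong refl step)
  finally show ?thesis .
qed

lemma hcomp_unique:
  assumes "a 0 = 1"
    and "\<And>n. of_nat (Suc n) * a (Suc n) = (\<Sum>j = 1..Suc n. of_nat j * u j * a (Suc n - j))"
  shows "a n = hcomp u (int n)"
proof (induction n rule: less_induct)
  case (less n)
  show ?case
  proof (cases n)
    case 0
    then show ?thesis using assms(1) by simp
  next
    case (Suc k)
    have "of_nat (Suc k) * a (Suc k) = of_nat (Suc k) * hcomp u (int (Suc k))"
      unfolding assms(2) hcomp_recurrence using less Suc by (intro sum.cong) auto
    then show ?thesis unfolding Suc by (rule of_nat_cancel_poly)
  qed
qed

definition addx :: "(nat \<Rightarrow> poly) \<Rightarrow> int \<Rightarrow> nat \<Rightarrow> poly" where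
  "addx u x j = u j + pconst (1 / of_nat j) * pvar (X x) ^ j"

lemma addx_commute: "addx (addx u x) y = addx (addx u y) x"
  by (simp add: addx_def fun_eq_iff)

text \<open>The generating series of the \<open>hcomp u n\<close> is \<open>exp (\<Sum>j. u j z^j)\<close>, and the shift by \<open>[x]\<close>
  multiplies it by \<open>1 / (1 - x z)\<close>.\<close>

lemma hcomp_addx: "hcomp u k = hcomp (addx u x) k - pvar (X x) * hcomp (addx u x) (k - 1)"
proof -
  define y where "y = pvar (X x)"
  define h where "h n = hcomp (addx u x) (int n)" for n
  define A where "A n = (\<Sum>j = 1..n. of_nat j * u j * h (n - j))" for n
  define S where "S n = (\<Sum>j = 1..n. y ^ j * h (n - j))" for n
  have rec: "of_nat n * h n = A n + S n" for n
  proof -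
    have "of_nat j * addx u x j = of_nat j * u j + y ^ j" if "j \<in> {1..n}" for j
    proof -
      have "of_nat j * pconst (1 / of_nat j) = 1"
        unfolding of_nat_mult_pconst using that by simp
      then show ?thesis by (simp add: addx_def distrib_left y_def flip: mult.assoc)
    qed
    then show ?thesis
      unfolding h_def hcomp_recurrence A_def S_def sum.distrib[symmetric]
      by (intro sum.cong refl) (simp add: distrib_right)
  qed
  have S_Suc: "S (Suc n) = y * h n + y * S n" for n
  proof -
    have "S (Suc n) = y * h n + (\<Sum>j = Suc 1..Suc n. y ^ j * h (Suc n - j))"
      unfolding S_def by (subst sum.atLeast_Suc_atMost) auto
    also have "(\<Sum>j = Suc 1..Suc n. y ^ j * h (Suc n - j)) = y * S n"
      unfolding S_def by (subst sum.shift_bounds_cl_Suc_ivl) (simp add: sum_distrib_left mult.assoc)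
    finally show ?thesis .
  qed
  \<comment> \<open>The coefficients of \<open>1 - y z\<close> times the series of \<open>h\<close>.
    In their recurrence the power sums \<open>S\<close> of the added variable cancel by
    \<open>S_Suc\<close>, which leaves the recurrence for \<open>u\<close>.\<close>
  define b where "b n = h n - (if n = 0 then 0 else y * h (n - 1))" for n
  have "b n = hcomp u (int n)" for n
  proof (rule hcomp_unique)
    show "b 0 = 1" by (simp add: b_def h_def)
    fix n
    have A_Suc: "A (Suc n) = (\<Sum>j = 1..n. of_nat j * u j * h (Suc n - j)) + of_nat (Suc n) * u (Suc n) * h 0"
      by (simp add: A_def)
    have "of_nat (Suc n) * b (Suc n) = of_nat (Suc n) * h (Suc n) - y * (of_nat n * h n) - y * h n"
      by (simp add: b_def algebra_simps)
    also have "\<dots> = A (Suc n) - y * A n"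
      unfolding rec S_Suc by (simp add: algebra_simps)
    also have "\<dots> = (\<Sum>j = 1..n. of_nat j * u j * b (Suc n - j)) + of_nat (Suc n) * u (Suc n) * b 0"
    proof -
      have "(\<Sum>j = 1..n. of_nat j * u j * b (Suc n - j)) =
          (\<Sum>j = 1..n. of_nat j * u j * h (Suc n - j) - y * (of_nat j * u j * h (n - j)))"
        by (intro sum.cong refl) (auto simp: b_def Suc_diff_le algebra_simps)
      then show ?thesis unfolding A_Suc by (simp add: A_def b_def sum_subtractf sum_distrib_left)
    qed
    finally show "of_nat (Suc n) * b (Suc n) = (\<Sum>j = 1..Suc n. of_nat j * u j * b (Suc n - j))"
      by simp
  qed
  from this[of "nat k"] show ?thesis
    by (cases "k < 0"; cases "k = 0") (auto simp: b_def h_def y_def of_nat_diff nat_diff_distrib)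
qed

section \<open>Alternating multilinear sums\<close>

text \<open>The increasing enumeration of the natural numbers other than \<open>j\<close>: it
  describes a list with position \<open>j\<close> deleted.\<close>

definition skip :: "nat \<Rightarrow> nat \<Rightarrow> nat" where
  "skip j i = (if i < j then i else Suc i)"

lemma prod_skip:
  assumes "j \<le> n"
  shows "(\<Prod>i<Suc n. f i) = f j * (\<Prod>i<n. f (skip j i) :: 'b::comm_monoid_mult)"
proof -
  have "(\<Prod>i<Suc n. f i) = f j * (\<Prod>i\<in>{..<Suc n} - {j}. f i)"
    using assms by (intro prod.remove) auto
  also have "(\<Prod>i\<in>{..<Suc n} - {j}. f i) = (\<Prod>i<n. f (skip j i))"
    using assms
    by (intro prod.reindex_bij_witness[of _ "skip j" "\<lambda>i. if i < j then i else i - 1"]) (auto simp: skip_def)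
  finally show ?thesis .
qed

lemma nth_skip:
  assumes "j < length L" "i < length L - 1"
  shows "(take j L @ drop (Suc j) L) ! i = L ! skip j i"
  using assms by (auto simp: skip_def nth_append)

section \<open>Multilinear forms given by their values on basis vectors\<close>

definition tuples :: "int set \<Rightarrow> nat \<Rightarrow> int list set" where
  "tuples S n = {ls. set ls \<subseteq> S \<and> length ls = n}"

lemma finite_tuples: "finite S \<Longrightarrow> finite (tuples S n)"
  unfolding tuples_def by (rule finite_lists_length_eq)

text \<open>The \<open>n\<close>-linear form with value \<open>g ls\<close> on the basis vectors
  indexed by \<open>ls\<close>, evaluated at the vectors \<open>Z 0, ..., Z (n - 1)\<close> with
  coordinates indexed by \<open>S\<close>.\<close>

definition multisum :: "int set \<Rightarrow> (int list \<Rightarrow> 'b::comm_ring_1) \<Rightarrow> nat \<Rightarrow> (nat \<Rightarrow> int \<Rightarrow> 'b) \<Rightarrow> 'b" where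
  "multisum S g n Z = (\<Sum>ls\<in>tuples S n. g ls * (\<Prod>i<n. Z i (ls ! i)))"

lemma multisum_cong:
  assumes "\<And>i l. i < n \<Longrightarrow> Z i l = Z' i l"
  shows "multisum S g n Z = multisum S g n Z'"
  unfolding multisum_def using assms by simp

lemma multisum_linear:
  assumes "p < n"
  shows "multisum S g n (Z(p := \<lambda>l. a * y l + b * z l)) =
    a * multisum S g n (Z(p := y)) + b * multisum S g n (Z(p := z))"
proof -
  have upd: "(\<Prod>i<n. (Z(p := y)) i (ls ! i)) = y (ls ! p) * (\<Prod>i\<in>{..<n} - {p}. Z i (ls ! i))" for y ls
    using assms by (subst prod.remove[of _ p]) (auto intro!: prod.cong)
  show ?thesis
    unfolding multisum_def upd sum_distrib_left sum.distrib[symmetric]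
    by (intro sum.cong refl) (simp add: algebra_simps)
qed

lemma multisum_last:
  "multisum S g (Suc n) Z =
    (\<Sum>ls\<in>tuples S n. \<Sum>l\<in>S. g (ls @ [l]) * (\<Prod>i<n. Z i (ls ! i)) * Z n l)"
proof -
  have "multisum S g (Suc n) Z =
    (\<Sum>(ls, l)\<in>tuples S n \<times> S. g (ls @ [l]) * (\<Prod>i<n. Z i (ls ! i)) * Z n l)"
    unfolding multisum_def
  proof (rule sum.reindex_bij_witness[of _ "\<lambda>(ls, l). ls @ [l]" "\<lambda>ls. (butlast ls, last ls)"])
    fix ls assume ls: "ls \<in> tuples S (Suc n)"
    then have ne: "ls \<noteq> []" by (auto simp: tuples_def)
    show "(case (butlast ls, last ls) of (ls, l) \<Rightarrow> ls @ [l]) = ls" using ne by simp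
    show "(butlast ls, last ls) \<in> tuples S n \<times> S"
      using ls ne by (auto simp: tuples_def dest: in_set_butlastD)
    have "(\<Prod>i<n. Z i (butlast ls ! i)) = (\<Prod>i<n. Z i (ls ! i))"
      using ls by (intro prod.cong refl) (auto simp: tuples_def nth_butlast)
    moreover have last: "last ls = ls ! n" using ls ne by (simp add: tuples_def last_conv_nth)
    moreover have "butlast ls @ [ls ! n] = ls" using ne by (simp flip: last)
    ultimately show "(case (butlast ls, last ls) of (ls, l) \<Rightarrow> g (ls @ [l]) * (\<Prod>i<n. Z i (ls ! i)) * Z n l) =
        g ls * (\<Prod>i<Suc n. Z i (ls ! i))"
      using ne by (simp add: mult.assoc)
  qed (auto simp: tuples_def)
  then show ?thesis by (simp add: sum.cartesian_product)
qed

lemma sum_tuples_insert: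
  assumes "j \<le> n"
  shows "(\<Sum>l\<in>S. \<Sum>ls\<in>tuples S n. f l ls) = (\<Sum>ls\<in>tuples S (Suc n). f (ls ! j) (take j ls @ drop (Suc j) ls))"
  unfolding sum.cartesian_product
proof (rule sum.reindex_bij_witness[of _ "\<lambda>ls. (ls ! j, take j ls @ drop (Suc j) ls)" "\<lambda>(l, ls). take j ls @ l # drop j ls"])
  fix p assume p: "p \<in> S \<times> tuples S n"
  obtain l ls where [simp]: "p = (l, ls)" by (cases p)
  have len: "length ls = n" using p by (auto simp: tuples_def)
  then have at: "(take j ls @ l # drop j ls) ! j = l"
    and rest: "take j (take j ls @ l # drop j ls) @ drop (Suc j) (take j ls @ l # drop j ls) = ls"
    using assms by (auto simp: nth_append)
  show "(case p of (l, ls) \<Rightarrow> take j ls @ l # drop j ls) \<in> tuples S (Suc n)"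
    using p assms by (auto simp: tuples_def dest: in_set_takeD in_set_dropD)
  show "(\<lambda>ls. (ls ! j, take j ls @ drop (Suc j) ls)) (case p of (l, ls) \<Rightarrow> take j ls @ l # drop j ls) = p"
    using at rest by simp
  show "f ((case p of (l, ls) \<Rightarrow> take j ls @ l # drop j ls) ! j)
      (take j (case p of (l, ls) \<Rightarrow> take j ls @ l # drop j ls) @ drop (Suc j) (case p of (l, ls) \<Rightarrow> take j ls @ l # drop j ls)) =
      (case p of (l, ls) \<Rightarrow> f l ls)"
    using at rest by simp
next
  fix ls assume ls: "ls \<in> tuples S (Suc n)"
  then have j: "j < length ls" using assms by (auto simp: tuples_def)
  show "(case (ls ! j, take j ls @ drop (Suc j) ls) of (l, ls) \<Rightarrow> take j ls @ l # drop j ls) = ls"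
    using j by (simp add: id_take_nth_drop[symmetric])
  show "(ls ! j, take j ls @ drop (Suc j) ls) \<in> S \<times> tuples S n"
    using ls j by (auto simp: tuples_def dest: in_set_takeD in_set_dropD)
qed

text \<open>By multilinearity it is enough to know the quadratic relation on basis vectors.\<close>

lemma multisum_pluecker:
  assumes "finite S"
    and "\<And>is js. is \<in> tuples S m \<Longrightarrow> js \<in> tuples S (Suc (Suc m)) \<Longrightarrow>
      (\<Sum>j<Suc (Suc m). (-1) ^ j * g (is @ [js ! j]) * g (take j js @ drop (Suc j) js)) = 0"
  shows "(\<Sum>j<Suc (Suc m). (-1) ^ j * multisum S g (Suc m) (\<lambda>i. if i < m then P i else Q j)
    * multisum S g (Suc m) (\<lambda>i. Q (skip j i))) = 0"
proof -
  define p where "p is = (\<Prod>i<m. P i (is ! i))" for "is" :: "int list"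
  define q where "q js = (\<Prod>i<Suc (Suc m). Q i (js ! i))" for js :: "int list"
  have "(-1) ^ j * multisum S g (Suc m) (\<lambda>i. if i < m then P i else Q j)
      * multisum S g (Suc m) (\<lambda>i. Q (skip j i)) =
    (\<Sum>is\<in>tuples S m. \<Sum>js\<in>tuples S (Suc (Suc m)).
      p is * q js * ((-1) ^ j * g (is @ [js ! j]) * g (take j js @ drop (Suc j) js)))"
    if j: "j < Suc (Suc m)" for j
  proof -
    let ?r = "\<lambda>ls. g ls * (\<Prod>i<Suc m. Q (skip j i) (ls ! i))"
    have "(-1) ^ j * multisum S g (Suc m) (\<lambda>i. if i < m then P i else Q j)
      * multisum S g (Suc m) (\<lambda>i. Q (skip j i)) =
      (\<Sum>ls\<in>tuples S (Suc m). \<Sum>is\<in>tuples S m. \<Sum>l\<in>S.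
        (-1) ^ j * (g (is @ [l]) * p is * Q j l) * ?r ls)"
      by (subst multisum_last) (simp add: multisum_def p_def sum_distrib_left sum_distrib_right del: prod.lessThan_Suc)
    also have "\<dots> = (\<Sum>is\<in>tuples S m. \<Sum>l\<in>S. \<Sum>ls\<in>tuples S (Suc m).
        (-1) ^ j * (g (is @ [l]) * p is * Q j l) * ?r ls)"
      by (subst sum.swap, intro sum.cong refl, rule sum.swap)
    \<comment> \<open>The last index \<open>l\<close> of the first factor is put into position
      \<open>j\<close> of the list of the second, so that all \<open>j\<close> sum over the same
      pairs \<open>(is, js)\<close>.\<close>
    also have "\<dots> = (\<Sum>is\<in>tuples S m. \<Sum>js\<in>tuples S (Suc (Suc m)).
        (-1) ^ j * (g (is @ [js ! j]) * p is * Q j (js ! j)) * ?r (take j js @ drop (Suc j) js))"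
      using j by (intro sum.cong refl sum_tuples_insert) simp
    also have "\<dots> = (\<Sum>is\<in>tuples S m. \<Sum>js\<in>tuples S (Suc (Suc m)).
      p is * q js * ((-1) ^ j * g (is @ [js ! j]) * g (take j js @ drop (Suc j) js)))"
    proof (intro sum.cong refl)
      fix "is" js assume js: "js \<in> tuples S (Suc (Suc m))"
      have "(\<Prod>i<Suc m. Q (skip j i) ((take j js @ drop (Suc j) js) ! i)) =
          (\<Prod>i<Suc m. Q (skip j i) (js ! skip j i))"
        using js j by (intro prod.cong refl arg_cong2[of _ _ _ _ Q] arg_cong[of _ _ "Q _"] nth_skip)
          (auto simp: tuples_def)
      moreover have "q js = Q j (js ! j) * (\<Prod>i<Suc m. Q (skip j i) (js ! skip j i))"
        unfolding q_def using j by (intro prod_skip) simp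
      ultimately show "(-1) ^ j * (g (is @ [js ! j]) * p is * Q j (js ! j)) * ?r (take j js @ drop (Suc j) js) =
        p is * q js * ((-1) ^ j * g (is @ [js ! j]) * g (take j js @ drop (Suc j) js))"
        by (simp only: mult_ac)
    qed
    finally show ?thesis .
  qed
  then have "(\<Sum>j<Suc (Suc m). (-1) ^ j * multisum S g (Suc m) (\<lambda>i. if i < m then P i else Q j)
    * multisum S g (Suc m) (\<lambda>i. Q (skip j i))) =
    (\<Sum>j<Suc (Suc m). \<Sum>is\<in>tuples S m. \<Sum>js\<in>tuples S (Suc (Suc m)).
      p is * q js * ((-1) ^ j * g (is @ [js ! j]) * g (take j js @ drop (Suc j) js)))"
    by (intro sum.cong refl) simp
  also have "\<dots> = (\<Sum>is\<in>tuples S m. \<Sum>js\<in>tuples S (Suc (Suc m)). \<Sum>j<Suc (Suc m).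
      p is * q js * ((-1) ^ j * g (is @ [js ! j]) * g (take j js @ drop (Suc j) js)))"
    by (subst sum.swap, rule sum.cong[OF refl], rule sum.swap)
  also have "\<dots> = 0"
    unfolding sum_distrib_left[symmetric] using assms(2) by (intro sum.neutral ballI) (simp del: sum.lessThan_Suc)
  finally show ?thesis .
qed

text \<open>Exchanging the entries \<open>p\<close> and \<open>q\<close> permutes the summation
  range, preserves the product because the two vectors are equal, and negates \<open>g\<close>. So
  the sum is its own negative, and \<open>two\<close> makes it zero.\<close>

lemma multisum_alternating:
  fixes g :: "int list \<Rightarrow> 'b::comm_ring_1"
  assumes two: "\<And>x :: 'b. x = - x \<Longrightarrow> x = 0"
    and anti: "\<And>L i j. i < length L \<Longrightarrow> j < length L \<Longrightarrow> i \<noteq> j \<Longrightarrow> g (L[i := L ! j, j := L ! i]) = - g L"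
    and "p < n" "q < n" "p \<noteq> q" "Z p = Z q"
  shows "multisum S g n Z = 0"
proof (rule two)
  let ?sw = "\<lambda>L :: int list. L[p := L ! q, q := L ! p]"
  have inv: "?sw (?sw L) = L" if "L \<in> tuples S n" for L
    using that assms(3,4,5) by (intro nth_equalityI) (auto simp: tuples_def nth_list_update)
  have mem: "?sw L \<in> tuples S n" if "L \<in> tuples S n" for L
    using that assms(3,4) by (auto simp: tuples_def set_swap)
  have "multisum S g n Z = (\<Sum>L\<in>tuples S n. g (?sw L) * (\<Prod>i<n. Z i (?sw L ! i)))"
    unfolding multisum_def
    by (rule sum.reindex_bij_witness[of _ ?sw ?sw]) (simp_all add: inv mem)
  also have "\<dots> = (\<Sum>L\<in>tuples S n. - (g L * (\<Prod>i<n. Z i (L ! i))))"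
  proof (intro sum.cong refl)
    fix L assume L: "L \<in> tuples S n"
    then have len: "length L = n" by (simp add: tuples_def)
    have "(\<Prod>i<n. Z i (?sw L ! i)) = (\<Prod>i<n. Z i (L ! i))"
    proof (rule prod.reindex_bij_witness[of _ "Transposition.transpose p q" "Transposition.transpose p q"])
      fix i assume "i \<in> {..<n}"
      then show "Z (Transposition.transpose p q i) (L ! Transposition.transpose p q i) = Z i (?sw L ! i)"
        using assms(3-6) len by (auto simp: transpose_def nth_list_update)
    qed (use assms(3,4) in \<open>auto simp: transpose_def\<close>)
    then show "g (?sw L) * (\<Prod>i<n. Z i (?sw L ! i)) = - (g L * (\<Prod>i<n. Z i (L ! i)))"
      using anti[of p L q] assms(3-5) len by simp
  qed
  also have "\<dots> = - multisum S g n Z"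
    by (simp add: multisum_def sum_negf)
  finally show "multisum S g n Z = - multisum S g n Z" .
qed

locale alternating_sum =
  fixes S :: "int set" and g :: "int list \<Rightarrow> 'b::comm_ring_1"
  assumes fin: "finite S"
    and two: "\<And>x :: 'b. x = - x \<Longrightarrow> x = 0"
    and anti: "\<And>L i j. i < length L \<Longrightarrow> j < length L \<Longrightarrow> i \<noteq> j \<Longrightarrow> g (L[i := L ! j, j := L ! i]) = - g L"
begin

lemma alternating: "p < n \<Longrightarrow> q < n \<Longrightarrow> p \<noteq> q \<Longrightarrow> Z p = Z q \<Longrightarrow> multisum S g n Z = 0"
  by (rule multisum_alternating[OF two anti])

lemma row_op:
  assumes "i < n" "p < n" "i \<noteq> p"
  shows "multisum S g n (Z(i := \<lambda>l. a * Z i l + b * Z p l)) = a * multisum S g n Z"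
  using assms multisum_linear[of i n S g Z a "Z i" b "Z p"] alternating[of i n p "Z(i := Z p)"]
  by simp

text \<open>The pivot \<open>p\<close> lies outside \<open>A\<close> and is left unchanged, so the
  operations can be carried out one row at a time.\<close>

lemma row_ops:
  assumes "A \<subseteq> {..<n}" "p < n" "p \<notin> A"
  shows "multisum S g n (\<lambda>i. if i \<in> A then (\<lambda>l. a i * Z i l + b i * Z p l) else Z i) = prod a A * multisum S g n Z"
proof -
  have "finite A" using assms(1) finite_subset by blast
  then show ?thesis using assms
  proof (induction A)
    case (insert x A)
    let ?Z = "\<lambda>i. if i \<in> A then (\<lambda>l. a i * Z i l + b i * Z p l) else Z i"
    have "(\<lambda>i. if i \<in> insert x A then (\<lambda>l. a i * Z i l + b i * Z p l) else Z i) =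
      ?Z(x := \<lambda>l. a x * ?Z x l + b x * ?Z p l)"
      using insert by (auto simp: fun_eq_iff)
    then show ?case using insert row_op[of x n p ?Z "a x" "b x"] by (simp add: mult.assoc)
  qed simp
qed

end

section \<open>Partitions and the tau function\<close>

lemma parts_sorted: "sorted_wrt (\<ge>) (parts la)" and parts_nonzero: "0 \<notin> set (parts la)"
  using Rep_partition[of la] by (auto simp: parts_def)

lemma part_beyond: "length (parts la) < i \<Longrightarrow> part la i = 0"
  by (simp add: part_def)

lemma part_antimono: "1 \<le> i \<Longrightarrow> i \<le> j \<Longrightarrow> part la j \<le> part la i"
  using sorted_wrt_nth_less[OF parts_sorted, of "i - 1" "j - 1" la]
  by (cases "i = j") (auto simp: part_def)

lemma map_part:
  assumes "length (parts la) \<le> M"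
  shows "map (part la) [1..<Suc M] = parts la @ replicate (M - length (parts la)) 0"
  using assms by (intro nth_equalityI) (auto simp: part_def nth_append simp del: upt_Suc)

lemma sum_part:
  assumes "length (parts la) \<le> M"
  shows "(\<Sum>i = 1..M. part la i) = psize la"
proof -
  have "(\<Sum>i = 1..M. part la i) = sum_list (map (part la) [1..<Suc M])"
    by (simp add: interv_sum_list_conv_sum_set_nat atLeastLessThanSuc_atLeastAtMost del: upt_Suc)
  then show ?thesis unfolding map_part[OF assms] by (simp add: psize_def sum_list_replicate)
qed

lemma length_parts_le_psize: "length (parts la) \<le> psize la"
proof -
  have "length xs \<le> sum_list xs" if "0 \<notin> set xs" for xs :: "nat list"
    using that by (induction xs) auto
  then show ?thesis using parts_nonzero by (simp add: psize_def)
qed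

lemma part_le_psize: "part la i \<le> psize la"
  unfolding part_def psize_def by (auto intro: member_le_sum_list)

text \<open>The \<open>M\<close> largest elements of the Maya diagram of \<open>la\<close>, in
  decreasing order; beyond the last part, \<open>part\<close> supplies 0.\<close>

definition beta :: "nat \<Rightarrow> partition \<Rightarrow> int list" where
  "beta M la = map (\<lambda>i. int (part la i) - int i) [1..<Suc M]"

lemma length_beta [simp]: "length (beta M la) = M"
  by (simp add: beta_def)

lemma beta_nth: "i < M \<Longrightarrow> beta M la ! i = int (part la (Suc i)) - int (Suc i)"
  by (simp add: beta_def del: upt_Suc)

lemma sorted_distinct_rev_beta: "sorted (rev (beta M la))" "distinct (beta M la)"
proof -
  have "sorted_wrt (>) (beta M la)"
    unfolding sorted_wrt_iff_nth_less
  proof (intro allI impI)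
    fix i j assume "i < j" "j < length (beta M la)"
    then show "beta M la ! j < beta M la ! i"
      using part_antimono[of "Suc i" "Suc j" la] by (simp add: beta_nth)
  qed
  then have *: "sorted_wrt (<) (rev (beta M la))" by (simp only: sorted_wrt_rev)
  then show "sorted (rev (beta M la))" "distinct (beta M la)"
    using *[unfolded strict_sorted_iff] by simp_all
qed

text \<open>In a weakly decreasing list the zeros form a tail, so dropping them moves no other
  entry, and the default 0 of \<open>part\<close> restores them.\<close>

lemma filter_nonzero_nth:
  assumes "sorted_wrt (\<ge>) xs" "i < length xs"
  shows "(if i < length (filter (\<lambda>x. x \<noteq> 0) xs) then filter (\<lambda>x. x \<noteq> 0) xs ! i else 0) = (xs ! i :: nat)"
  using assms
proof (induction xs arbitrary: i)
  case (Cons x xs)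
  show ?case
  proof (cases "x = 0")
    case True
    then have "\<forall>y\<in>set (x # xs). y = 0" using Cons.prems by auto
    then have "filter (\<lambda>x. x \<noteq> 0) (x # xs) = []" by (auto simp: filter_empty_conv)
    moreover have "(x # xs) ! i = 0"
      using nth_mem[OF Cons.prems(2)] \<open>\<forall>y\<in>set (x # xs). y = 0\<close> by blast
    ultimately show ?thesis by simp
  next
    case False
    show ?thesis
    proof (cases i)
      case (Suc i')
      then show ?thesis using Cons.IH[of i'] Cons.prems False by (simp del: neq0_conv split: if_splits)
    qed (use False in simp)
  qed
qed simp

lemma lam_of_beta:
  assumes "distinct L" "length L = k" "set L \<subseteq> {- int k..}"
  shows "sort L = rev (beta k (lam_of L))" "length (parts (lam_of L)) \<le> k"
proof -
  define L' where "L' = sort L"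
  have len: "length L' = k" using assms by (simp add: L'_def)
  have strict: "L' ! i < L' ! j" if "i < j" "j < k" for i j
    using that assms sorted_wrt_nth_less[of "(<)" L' i j] by (simp add: L'_def strict_sorted_iff)
  \<comment> \<open>A strictly increasing integer list gains at least one per step. This keeps the
    arguments of \<open>nat\<close> in \<open>lam_of\<close> nonnegative, so nothing is
    truncated.\<close>
  have lower: "- int k + int i \<le> L' ! i" if "i < k" for i
    using that
  proof (induction i)
    case 0
    then have "L' ! 0 \<in> set L" using len nth_mem[of 0 L'] by (simp add: L'_def)
    then show ?case using assms(3) by auto
  next
    case (Suc i)
    then show ?case using strict[of i "Suc i"] by simp
  qed
  define xs where "xs = map (\<lambda>i. nat (L' ! (k - i) + int i)) [1..<k+1]"
  have xs_nth: "xs ! i = nat (L' ! (k - Suc i) + int (Suc i))" if "i < k" for i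
    using that by (simp add: xs_def del: upt_Suc)
  have len_xs: "length xs = k" by (simp add: xs_def)
  have step: "L' ! i + 1 \<le> L' ! Suc i" if "Suc i < k" for i using strict[of i "Suc i"] that by simp
  have mono: "L' ! i - int i \<le> L' ! j - int j" if "i \<le> j" "j < k" for i j
    using that
  proof (induction j)
    case (Suc j)
    then show ?case using step[of j] by (cases "i = Suc j") auto
  qed simp
  have sorted: "sorted_wrt (\<ge>) xs"
    unfolding sorted_wrt_iff_nth_less len_xs
  proof (intro allI impI)
    fix i j assume "i < j" "j < k"
    then have "L' ! (k - Suc j) - int (k - Suc j) \<le> L' ! (k - Suc i) - int (k - Suc i)"
      by (intro mono) auto
    then show "xs ! j \<le> xs ! i" using \<open>i < j\<close> \<open>j < k\<close> by (simp add: xs_nth of_nat_diff)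
  qed
  have parts: "parts (lam_of L) = filter (\<lambda>x. x \<noteq> 0) xs"
    unfolding lam_of_def parts_def Let_def assms(2) L'_def[symmetric] xs_def[symmetric]
    by (subst Abs_partition_inverse) (auto intro: sorted_wrt_filter sorted)
  show "length (parts (lam_of L)) \<le> k"
    unfolding parts using length_filter_le[of _ xs] len_xs by simp
  have part: "int (part (lam_of L) (Suc i)) = L' ! (k - Suc i) + int (Suc i)" if "i < k" for i
    using filter_nonzero_nth[OF sorted, of i] that lower[of "k - Suc i"]
    by (auto simp: part_def parts len_xs xs_nth of_nat_diff split: if_splits)
  show "sort L = rev (beta k (lam_of L))"
    unfolding L'_def[symmetric]
  proof (rule nth_equalityI)
    fix i assume "i < length L'"
    then show "L' ! i = rev (beta k (lam_of L)) ! i"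
      using len part[of "k - Suc i"] by (simp add: rev_nth beta_nth)
  qed (simp add: len)
qed

lemma mset_lam_of:
  assumes "distinct L" "length L = k" "set L \<subseteq> {- int k..}"
  shows "mset L = mset (beta k (lam_of L))"
  using lam_of_beta(1)[OF assms] by (metis mset_rev mset_sort)

text \<open>\<open>M\<close> may exceed the number of parts: the surplus entries give zero parts,
  which \<open>lam_of\<close> drops.\<close>

lemma lam_of_eq:
  assumes "mset L = mset (beta M la)" "length (parts la) \<le> M"
  shows "lam_of L = la"
proof -
  have len: "length L = M" using mset_eq_length[OF assms(1)] by simp
  have sort: "sort L = rev (beta M la)"
    using sorted_distinct_rev_beta(1)[of M la] assms(1) by (intro properties_for_sort) simp_all
  have "map (\<lambda>i. nat (sort L ! (M - i) + int i)) [1..<M+1] = map (part la) [1..<Suc M]"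
    unfolding sort by (intro nth_equalityI) (auto simp: rev_nth beta_nth simp del: upt_Suc)
  then have "lam_of L = Abs_partition (filter (\<lambda>x. x \<noteq> 0) (map (part la) [1..<Suc M]))"
    unfolding lam_of_def len Let_def by (rule arg_cong[of _ _ "\<lambda>xs. Abs_partition (filter (\<lambda>x. x \<noteq> 0) xs)"])
  also have "filter (\<lambda>x. x \<noteq> 0) (map (part la) [1..<Suc M]) = parts la"
  proof -
    have "filter (\<lambda>x. x \<noteq> 0) (parts la) = parts la"
      by (rule filter_True) (use parts_nonzero[of la] in \<open>auto intro: gr0I\<close>)
    then show ?thesis unfolding map_part[OF assms(2)] by (simp add: filter_replicate)
  qed
  finally show ?thesis by (simp add: parts_def Rep_partition_inverse)
qed

lemma set_beta:
  assumes "psize la \<le> M"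
  shows "set (beta M la) \<subseteq> {- int M .. int M - 1}"
proof
  fix l assume "l \<in> set (beta M la)"
  then obtain i where "1 \<le> i" "i \<le> M" "l = int (part la i) - int i"
    by (auto simp: beta_def simp del: upt_Suc)
  then show "l \<in> {- int M .. int M - 1}" using part_le_psize[of la i] assms by simp
qed

section \<open>Jacobi-Trudi expansion of the tau function\<close>

lemma bij_betw_permutes_arrangements:
  assumes inj: "inj_on e {1..M}"
  shows "bij_betw (\<lambda>\<sigma>. rev (map (\<lambda>i. e (\<sigma> i)) [1..<Suc M])) {\<sigma>. \<sigma> permutes {1..M}}
    {ls. mset ls = mset (map e [1..<Suc M])}"
    (is "bij_betw ?f ?P ?A")
proof -
  have inj_f: "inj_on ?f ?P"
  proof (rule inj_onI)
    fix \<sigma> \<tau> assume P: "\<sigma> \<in> ?P" "\<tau> \<in> ?P" and "?f \<sigma> = ?f \<tau>"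
    then have "\<forall>i\<in>set [1..<Suc M]. e (\<sigma> i) = e (\<tau> i)" by (simp only: rev_is_rev_conv map_eq_conv)
    then have eq: "e (\<sigma> i) = e (\<tau> i)" if "i \<in> {1..M}" for i
      using that by (simp only: atLeastLessThanSuc_atLeastAtMost set_upt)
    show "\<sigma> = \<tau>"
    proof
      fix i
      show "\<sigma> i = \<tau> i"
      proof (cases "i \<in> {1..M}")
        case True
        then show ?thesis
          using eq[OF True] P permutes_in_image[of \<sigma> "{1..M}" i] permutes_in_image[of \<tau> "{1..M}" i]
          by (auto dest!: inj_onD[OF inj])
      next
        case False
        then show ?thesis using P by (auto simp: permutes_not_in)
      qed
    qed
  qed
  let ?es = "map e [1..<Suc M]"
  have dist: "distinct ?es"
    using inj by (simp add: distinct_map atLeastLessThanSuc_atLeastAtMost del: upt_Suc)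
  have A: "?A = permutations_of_set (set ?es)"
  proof (intro set_eqI iffI)
    fix ls assume "ls \<in> ?A"
    then have m: "mset ls = mset ?es" by simp
    have "set ls = set ?es" using mset_eq_setD[OF m] .
    moreover have "distinct ls" using dist mset_eq_imp_distinct_iff[OF m] by simp
    ultimately show "ls \<in> permutations_of_set (set ?es)" by (intro permutations_of_setI)
  next
    fix ls assume "ls \<in> permutations_of_set (set ?es)"
    then have "set ls = set ?es" "distinct ls" by (auto dest: permutations_of_setD)
    then show "ls \<in> ?A" using dist set_eq_iff_mset_eq_distinct[of ls ?es] by blast
  qed
  have sub: "?f ` ?P \<subseteq> ?A"
  proof (intro image_subsetI CollectI)
    fix \<sigma> assume "\<sigma> \<in> ?P"
    then have \<sigma>: "\<sigma> permutes {1..M}" by simp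
    have "image_mset \<sigma> (mset [1..<Suc M]) = mset [1..<Suc M]"
      using permutes_image_mset[OF \<sigma>]
      by (metis atLeastLessThanSuc_atLeastAtMost distinct_upt mset_set_set set_upt)
    then have "mset (map \<sigma> [1..<Suc M]) = mset [1..<Suc M]" by (simp only: mset_map)
    then have "mset (map e (map \<sigma> [1..<Suc M])) = mset ?es" by (simp only: mset_map)
    then show "mset (?f \<sigma>) = mset ?es" by (simp only: mset_rev list.map_comp o_def)
  qed
  \<comment> \<open>Surjectivity by counting: there are \<open>fact M\<close> permutations and as
    many arrangements.\<close>
  have "card (?f ` ?P) = fact M" using inj_f by (simp add: card_image card_permutations[OF refl])
  moreover have "card (set ?es) = M" using distinct_card[OF dist] by (simp del: upt_Suc)
  then have "card ?A = fact M" unfolding A by (simp only: card_permutations_of_set[OF finite_set])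
  ultimately have "?f ` ?P = ?A"
    using card_subset_eq[OF _ sub] unfolding A by (simp only: finite_permutations_of_set)
  then show ?thesis using inj_f by (simp add: bij_betw_def)
qed

text \<open>An empty row \<open>Suc M\<close> has entry
  \<open>hcomp u (\<sigma> (Suc M) - Suc M)\<close>, which is 1 if \<open>\<sigma>\<close> fixes
  \<open>Suc M\<close> and has negative index otherwise. So the determinant does not depend on its
  size, and one \<open>M\<close> serves many partitions at once.\<close>

lemma schur_extend:
  assumes "length (parts la) \<le> M"
  shows "schur u la = (\<Sum>\<sigma> | \<sigma> permutes {1..M}. of_int (sign \<sigma>) *
        (\<Prod>i = 1..M. hcomp u (int (part la i) - int i + int (\<sigma> i))))"
  using assms
proof (induction M rule: dec_induct)
  case base
  then show ?case by (simp add: schur_def Let_def)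
next
  case (step M)
  let ?t = "\<lambda>M \<sigma>. of_int (sign \<sigma>) * (\<Prod>i = 1..M. hcomp u (int (part la i) - int i + int (\<sigma> i)))"
  have sub: "{\<sigma>. \<sigma> permutes {1..M}} \<subseteq> {\<sigma>. \<sigma> permutes {1..Suc M}}"
    by (auto intro: permutes_subset)
  have zero: "?t (Suc M) \<sigma> = 0" if \<sigma>: "\<sigma> permutes {1..Suc M}" "\<not> \<sigma> permutes {1..M}" for \<sigma>
  proof -
    have "\<sigma> (Suc M) \<noteq> Suc M"
    proof
      assume fix_M: "\<sigma> (Suc M) = Suc M"
      have "\<sigma> permutes {1..M}"
        by (rule permutes_superset[OF \<sigma>(1)]) (use fix_M in \<open>auto simp: le_Suc_eq\<close>)
      then show False using \<sigma>(2) by simp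
    qed
    moreover have "\<sigma> (Suc M) \<in> {1..Suc M}" using permutes_in_image[OF \<sigma>(1), of "Suc M"] by simp
    moreover have "part la (Suc M) = 0" using step by (intro part_beyond) simp
    ultimately have "hcomp u (int (part la (Suc M)) - int (Suc M) + int (\<sigma> (Suc M))) = 0" by simp
    then show ?thesis by simp
  qed
  have same: "?t (Suc M) \<sigma> = ?t M \<sigma>" if \<sigma>: "\<sigma> permutes {1..M}" for \<sigma>
  proof -
    have "\<sigma> (Suc M) = Suc M" using \<sigma> by (simp add: permutes_not_in)
    moreover have "part la (Suc M) = 0" using step by (intro part_beyond) simp
    ultimately show ?thesis by simp
  qed
  have "(\<Sum>\<sigma> | \<sigma> permutes {1..Suc M}. ?t (Suc M) \<sigma>) = (\<Sum>\<sigma> | \<sigma> permutes {1..M}. ?t (Suc M) \<sigma>)"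
    using sub zero by (intro sum.mono_neutral_right finite_permutations) auto
  also have "\<dots> = (\<Sum>\<sigma> | \<sigma> permutes {1..M}. ?t M \<sigma>)"
    by (intro sum.cong refl same) simp
  finally show ?case using step.IH by (simp only:)
qed

text \<open>The power of \<open>fps_X\<close> records the degree; for \<open>k < 0\<close> the
  coefficient is 0, so the truncation by \<open>nat\<close> is harmless.\<close>

definition hz :: "(nat \<Rightarrow> poly) \<Rightarrow> int \<Rightarrow> pser" where
  "hz u k = fps_const (hcomp u k) * fps_X ^ nat k"

definition fconst :: "complex \<Rightarrow> pser" where
  "fconst c = fps_const (pconst c)"

lemma coeff_hom_fconst: "coeff_hom fconst"
  by unfold_locales (simp_all add: fconst_def pconst_add pconst_mult fps_const_add fps_const_mult)

lemma fps_const_prod: "fps_const (prod f A) = (\<Prod>i\<in>A. fps_const (f i))"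
  by (induction A rule: infinite_finite_induct) (simp_all flip: fps_const_mult)

lemma fps_const_sum: "fps_const (sum f A) = (\<Sum>i\<in>A. fps_const (f i))"
  by (induction A rule: infinite_finite_induct) (simp_all flip: fps_const_add)

text \<open>Row indices \<open>i\<close> and column indices \<open>\<sigma> i\<close> have the same
  sum, so a Jacobi-Trudi term without negative indices has total degree
  \<open>psize la\<close>.\<close>

lemma sum_nat_shift:
  assumes "length (parts la) \<le> M" "\<sigma> permutes {1..M}"
    and nonneg: "\<And>i. i \<in> {1..M} \<Longrightarrow> 0 \<le> int (part la i) - int i + int (\<sigma> i)"
  shows "(\<Sum>i = 1..M. nat (int (part la i) - int i + int (\<sigma> i))) = psize la"
proof -
  have "int (\<Sum>i = 1..M. nat (int (part la i) - int i + int (\<sigma> i))) =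
      (\<Sum>i = 1..M. int (part la i)) - (\<Sum>i = 1..M. int i) + (\<Sum>i = 1..M. int (\<sigma> i))"
    unfolding of_nat_sum sum_subtractf[symmetric] sum.distrib[symmetric]
    by (intro sum.cong refl) (simp only: nonneg int_nat_eq if_True)
  also have "(\<Sum>i = 1..M. int (\<sigma> i)) = (\<Sum>i = 1..M. int i)"
    using sum.permute[OF assms(2), of int] by (simp add: o_def)
  also have "(\<Sum>i = 1..M. int (part la i)) = int (psize la)"
    using sum_part[OF assms(1)] by (simp flip: of_nat_sum)
  finally have "int (\<Sum>i = 1..M. nat (int (part la i) - int i + int (\<sigma> i))) = int (psize la)"
    by (simp only: diff_add_cancel)
  then show ?thesis by (simp only: of_nat_eq_iff)
qed

lemma prod_hz:
  assumes "length (parts la) \<le> M" "\<sigma> permutes {1..M}"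
  shows "(\<Prod>i = 1..M. hz u (int (part la i) - int i + int (\<sigma> i))) =
    fps_const (\<Prod>i = 1..M. hcomp u (int (part la i) - int i + int (\<sigma> i))) * fps_X ^ psize la"
\<comment> \<open>A negative index makes both sides vanish; it is separated because there
  \<open>nat\<close> would falsify the exponent.\<close>
proof (cases "\<exists>i\<in>{1..M}. int (part la i) - int i + int (\<sigma> i) < 0")
  case True
  then obtain i where i: "i \<in> {1..M}" "int (part la i) - int i + int (\<sigma> i) < 0" by blast
  then have z: "(\<Prod>i = 1..M. hz u (int (part la i) - int i + int (\<sigma> i))) = 0"
    "(\<Prod>i = 1..M. hcomp u (int (part la i) - int i + int (\<sigma> i))) = 0"
    by (auto simp: hz_def intro!: prod_zero bexI[of _ i])
  show ?thesis unfolding z by simp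
next
  case False
  then have "(\<Sum>i = 1..M. nat (int (part la i) - int i + int (\<sigma> i))) = psize la"
    by (intro sum_nat_shift[OF assms]) (meson linorder_not_less)
  then show ?thesis
    unfolding hz_def prod.distrib fps_const_prod by (simp flip: power_sum)
qed

definition tau :: "(partition \<Rightarrow> complex) \<Rightarrow> (nat \<Rightarrow> poly) \<Rightarrow> pser" where
  "tau w u = Abs_fps (\<lambda>d. \<Sum>la\<in>{la. psize la = d}. pconst (w la) * schur u la)"

definition hvec :: "(nat \<Rightarrow> poly) \<Rightarrow> nat \<Rightarrow> int \<Rightarrow> pser" where
  "hvec u j l = hz u (l + int j)"

definition box :: "nat \<Rightarrow> int set" where
  "box M = {- int M .. int M - 1}"

text \<open>The orderings of the index set of \<open>la\<close> together expand one Jacobi-Trudi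
  determinant. In the increasing ordering, of sign 1, position \<open>i\<close> holds the index of
  part \<open>M - i\<close> and meets the row of level \<open>M - i\<close>: this is the diagonal
  term.\<close>

lemma sum_arrangements:
  assumes "length (parts la) \<le> M"
  shows "(\<Sum>ls | mset ls = mset (beta M la). fconst (ptil w ls) * (\<Prod>i<M. hvec u (M - i) (ls ! i))) =
    fps_const (pconst (w la) * schur u la) * fps_X ^ psize la"
proof -
  interpret coeff_hom fconst by (rule coeff_hom_fconst)
  define e where "e i = int (part la i) - int i" for i
  let ?ls = "\<lambda>\<sigma>. rev (map (\<lambda>i. e (\<sigma> i)) [1..<Suc M])"
  have beta: "beta M la = map e [1..<Suc M]" by (simp add: beta_def e_def)
  have inj: "inj_on e {1..M}"
    using sorted_distinct_rev_beta(2)[of M la]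
    by (simp add: beta distinct_map atLeastLessThanSuc_atLeastAtMost del: upt_Suc)
  have bij: "bij_betw ?ls {\<sigma>. \<sigma> permutes {1..M}} {ls. mset ls = mset (beta M la)}"
    unfolding beta by (rule bij_betw_permutes_arrangements[OF inj])
  have ptil: "ptil w (?ls \<sigma>) = of_int (sign \<sigma>) * w la" if \<sigma>: "\<sigma> permutes {1..M}" for \<sigma>
  proof -
    have "?ls \<sigma> \<in> {ls. mset ls = mset (beta M la)}"
      using bij_betw_apply[OF bij, of \<sigma>] \<sigma> by blast
    then have "lam_of (?ls \<sigma>) = la" using lam_of_eq assms by blast
    moreover have "sortsign (?ls \<sigma>) = sign \<sigma> * sortsign (rev (beta M la))"
      unfolding sortsign_pairprod pairprod_rev beta
      by (subst pairprod_permutes[OF _ \<sigma>]) (simp_all add: sgn_if)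
    ultimately show ?thesis
      using sorted_distinct_rev_beta[of M la] by (simp add: ptil_def sortsign_sorted)
  qed
  have prod: "(\<Prod>i<M. hvec u (M - i) (?ls \<sigma> ! i)) = (\<Prod>i = 1..M. hz u (e (\<sigma> i) + int i))" for \<sigma>
    by (rule prod.reindex_bij_witness[of _ "\<lambda>i. M - i" "\<lambda>i. M - i"])
      (auto simp: hvec_def rev_nth Suc_diff_Suc simp del: upt_Suc)
  have inv: "(\<Prod>i = 1..M. hz u (e (inv \<sigma> i) + int i)) = (\<Prod>i = 1..M. hz u (e i + int (\<sigma> i)))"
    if \<sigma>: "\<sigma> permutes {1..M}" for \<sigma>
    using prod.permute[OF \<sigma>, of "\<lambda>i. hz u (e (inv \<sigma> i) + int i)"]
    by (simp add: o_def permutes_inverses(2)[OF \<sigma>])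
  have "(\<Sum>ls | mset ls = mset (beta M la). fconst (ptil w ls) * (\<Prod>i<M. hvec u (M - i) (ls ! i))) =
    (\<Sum>\<sigma> | \<sigma> permutes {1..M}. fconst (ptil w (?ls \<sigma>)) * (\<Prod>i<M. hvec u (M - i) (?ls \<sigma> ! i)))"
    by (rule sum.reindex_bij_betw[OF bij, symmetric])
  also have "\<dots> = (\<Sum>\<sigma> | \<sigma> permutes {1..M}. fconst (of_int (sign \<sigma>) * w la) * (\<Prod>i = 1..M. hz u (e (\<sigma> i) + int i)))"
    by (intro sum.cong refl) (simp only: prod ptil mem_Collect_eq)
  also have "\<dots> = (\<Sum>\<sigma> | \<sigma> permutes {1..M}. fconst (of_int (sign \<sigma>) * w la) * (\<Prod>i = 1..M. hz u (e i + int (\<sigma> i))))"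
  \<comment> \<open>Passing to inverses transposes the determinant: the lists permute the indices of
    the parts, \<open>schur\<close> permutes the columns.\<close>
  proof (subst sum_permutations_inverse, intro sum.cong refl)
    fix \<sigma> assume "\<sigma> \<in> {\<sigma>. \<sigma> permutes {1..M}}"
    then have \<sigma>: "\<sigma> permutes {1..M}" by simp
    then have "permutation \<sigma>" by (rule permutes_imp_permutation[OF finite_atLeastAtMost])
    then show "fconst (of_int (sign (inv \<sigma>)) * w la) * (\<Prod>i = 1..M. hz u (e (inv \<sigma> i) + int i)) =
        fconst (of_int (sign \<sigma>) * w la) * (\<Prod>i = 1..M. hz u (e i + int (\<sigma> i)))"
      by (simp only: inv[OF \<sigma>] sign_inverse)
  qed
  also have "\<dots> = (\<Sum>\<sigma> | \<sigma> permutes {1..M}. fps_const (pconst (w la) * (of_int (sign \<sigma>) *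
      (\<Prod>i = 1..M. hcomp u (int (part la i) - int i + int (\<sigma> i))))) * fps_X ^ psize la)"
  proof (intro sum.cong refl)
    fix \<sigma> assume "\<sigma> \<in> {\<sigma>. \<sigma> permutes {1..M}}"
    then have \<sigma>: "\<sigma> permutes {1..M}" by simp
    have sgn: "fconst (of_int (sign \<sigma>) * w la) = fps_const (pconst (w la)) * fps_const (of_int (sign \<sigma>))"
      by (simp add: fconst_def pconst_mult pconst_of_int mult.commute)
    show "fconst (of_int (sign \<sigma>) * w la) * (\<Prod>i = 1..M. hz u (e i + int (\<sigma> i))) =
      fps_const (pconst (w la) * (of_int (sign \<sigma>) *
        (\<Prod>i = 1..M. hcomp u (int (part la i) - int i + int (\<sigma> i))))) * fps_X ^ psize la"
      unfolding e_def by (simp only: sgn prod_hz[OF assms \<sigma>] fps_const_mult[symmetric] mult.assoc)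
  qed
  also have "\<dots> = fps_const (pconst (w la) * schur u la) * fps_X ^ psize la"
    unfolding schur_extend[OF assms] sum_distrib_left fps_const_sum sum_distrib_right ..
  finally show ?thesis .
qed

text \<open>Distinct index lists are grouped by their partition. All partitions of size at most
  \<open>M\<close> occur; larger ones, whether they occur or not, only affect degrees above
  \<open>M\<close>.\<close>

lemma multisum_tau:
  assumes "d \<le> M"
  shows "fps_nth (multisum (box M) (\<lambda>ls. fconst (ptil w ls)) M (\<lambda>i. hvec u (M - i))) d = fps_nth (tau w u) d"
proof -
  define D where "D = {ls \<in> tuples (box M) M. distinct ls}"
  have fin: "finite D" using finite_tuples[of "box M" M] by (simp add: D_def box_def)
  have D: "distinct ls" "length ls = M" "set ls \<subseteq> {- int M..}" if "ls \<in> D" for ls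
    using that by (auto simp: D_def tuples_def box_def)
  let ?t = "\<lambda>ls. fconst (ptil w ls) * (\<Prod>i<M. hvec u (M - i) (ls ! i))"
  have fiber: "{ls \<in> D. lam_of ls = la} = {ls. mset ls = mset (beta M la)}"
    and short: "length (parts la) \<le> M" if "la \<in> lam_of ` D" for la
  proof -
    from that obtain L where L: "L \<in> D" "la = lam_of L" by blast
    show short: "length (parts la) \<le> M" using lam_of_beta(2)[OF D[OF L(1)]] L(2) by simp
    have mL: "mset L = mset (beta M la)" using mset_lam_of[OF D[OF L(1)]] L(2) by simp
    show "{ls \<in> D. lam_of ls = la} = {ls. mset ls = mset (beta M la)}"
    proof (intro set_eqI iffI; clarsimp)
      fix ls assume "ls \<in> D" "la = lam_of ls"
      then show "mset ls = mset (beta M (lam_of ls))" using mset_lam_of[OF D] by blast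
    next
      fix ls assume m: "mset ls = mset (beta M la)"
      then have e: "mset ls = mset L" using mL by simp
      have "ls \<in> D"
        using L(1) mset_eq_setD[OF e] mset_eq_length[OF e] mset_eq_imp_distinct_iff[OF e]
        by (simp add: D_def tuples_def)
      then show "ls \<in> D \<and> lam_of ls = la" using lam_of_eq[OF m short] by simp
    qed
  qed
  have small: "la \<in> lam_of ` D" if "psize la \<le> M" for la
  proof
    have len: "length (parts la) \<le> M" using length_parts_le_psize[of la] that by simp
    show "la = lam_of (beta M la)" using lam_of_eq[OF refl len] by simp
    show "beta M la \<in> D"
      using set_beta[OF that] sorted_distinct_rev_beta(2) by (simp add: D_def tuples_def box_def)
  qed
  have "multisum (box M) (\<lambda>ls. fconst (ptil w ls)) M (\<lambda>i. hvec u (M - i)) = (\<Sum>ls\<in>D. ?t ls)"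
    unfolding multisum_def D_def
    by (intro sum.mono_neutral_right) (auto simp: finite_tuples box_def ptil_def sortsign_def fconst_def)
  also have "\<dots> = (\<Sum>la\<in>lam_of ` D. \<Sum>ls | ls \<in> D \<and> lam_of ls = la. ?t ls)"
    by (rule sum.image_gen[OF fin])
  also have "\<dots> = (\<Sum>la\<in>lam_of ` D. fps_const (pconst (w la) * schur u la) * fps_X ^ psize la)"
    by (intro sum.cong refl) (simp only: fiber sum_arrangements[OF short])
  finally have "fps_nth (multisum (box M) (\<lambda>ls. fconst (ptil w ls)) M (\<lambda>i. hvec u (M - i))) d =
      (\<Sum>la\<in>lam_of ` D. if psize la = d then pconst (w la) * schur u la else 0)"
    by (simp add: fps_sum_nth if_distrib[of "(*) _"] eq_commute cong: if_cong)
  also have "\<dots> = (\<Sum>la\<in>lam_of ` D \<inter> {la. psize la = d}. pconst (w la) * schur u la)"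
    using fin by (subst sum.inter_restrict) auto
  also have "lam_of ` D \<inter> {la. psize la = d} = {la. psize la = d}"
    using small assms by auto
  finally show ?thesis by (simp add: tau_def)
qed

section \<open>The bilinear identity\<close>

definition xz :: "int \<Rightarrow> pser" where
  "xz x = fps_const (pvar (X x)) * fps_X"

lemma xdiff_xz: "xdiff i j = xz i - xz j"
  by (simp add: xdiff_def xz_def left_diff_distrib flip: fps_const_sub)

lemma hz_addx: "hz u k = hz (addx u x) k - xz x * hz (addx u x) (k - 1)"
proof (cases "k \<le> 0")
  case True
  then show ?thesis by (cases "k = 0") (simp_all add: hz_def)
next
  case False
  then obtain n where "nat k = Suc n" "nat (k - 1) = n" by (metis Suc_nat_eq_nat_zadd1 diff_add_cancel add.commute zle_diff1_eq not_le)
  then show ?thesis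
    unfolding hz_def xz_def hcomp_addx[of u k x]
    by (simp add: algebra_simps flip: fps_const_sub fps_const_mult)
qed

lemma hvec_addx:
  assumes "0 < j"
  shows "hvec u j l = hvec (addx u x) j l - xz x * hvec (addx u x) (j - 1) l"
  using hz_addx[of u "l + int j" x] assms by (simp add: hvec_def of_nat_diff algebra_simps)

text \<open>Both one-point shifts are compared with the shift by \<open>x\<close> and
  \<open>y\<close>: the terms of level \<open>j\<close> agree, and the difference leaves one factor
  of the Vandermonde product.\<close>

lemma hvec_addx_diff:
  assumes "0 < j"
  shows "hvec (addx u y) j l = (xz y - xz x) * hvec (addx (addx u x) y) (j - 1) l + hvec (addx u x) j l"
  unfolding hvec_addx[of j "addx u y" l x, OF assms] hvec_addx[of j "addx u x" l y, OF assms]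
    addx_commute[of u y x]
  by (simp add: algebra_simps)

text \<open>All rows of entries of \<open>xs\<close> have the same level \<open>length xs\<close>,
  so each depends on its own entry only; this is what permits exchanging entries between
  lists.\<close>

definition hrows :: "nat \<Rightarrow> (nat \<Rightarrow> poly) \<Rightarrow> int list \<Rightarrow> nat \<Rightarrow> int \<Rightarrow> pser" where
  "hrows M u xs i = (if i < M - length xs then hvec u (M - i)
     else hvec (addx u (xs ! (i - (M - length xs)))) (length xs))"

text \<open>The row of \<open>x\<close> is the pivot: by \<open>hvec_addx_diff\<close>, each later
  row is a multiple of the wanted one plus the pivot. Each earlier row differs from its counterpart
  for \<open>addx u x\<close> by a multiple of the next row, by \<open>hvec_addx\<close>.\<close>

lemma hrows_Cons:
  fixes g :: "int list \<Rightarrow> pser"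
  assumes "alternating_sum S g" and "length xs < M"
  shows "multisum S g M (hrows M u (x # xs)) =
    prod_list (map (\<lambda>y. xz y - xz x) xs) * multisum S g M (hrows M (addx u x) xs)"
proof -
  interpret alternating_sum S g by fact
  define k where "k = length xs"
  define p where "p = M - Suc k"
  have p: "p < M" "M - k = Suc p" "M - length (x # xs) = p" "M - p = Suc k" "p + Suc k = M"
    using assms(2) by (auto simp: p_def k_def)
  define R where "R = hrows M (addx u x) xs"
  define Z where "Z t = (\<lambda>i. if i < t then hvec u (M - i) else R i)" for t
  have R_low: "R i = hvec (addx u x) (M - i)" if "i \<le> p" for i
    using that p by (simp add: R_def hrows_def k_def[symmetric])
  have R_high: "R i = hvec (addx (addx u x) (xs ! (i - Suc p))) k" if "p < i" for i
    using that p by (simp add: R_def hrows_def k_def[symmetric])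
  define a where "a i = xz (xs ! (i - Suc p)) - xz x" for i
  let ?A = "{p<..<M}"
  have "multisum S g M (hrows M u (x # xs)) =
      multisum S g M (\<lambda>i. if i \<in> ?A then (\<lambda>l. a i * Z p i l + 1 * Z p p l) else Z p i)"
  proof (rule multisum_cong)
    fix i l assume i: "i < M"
    consider "i < p" | "i = p" | "p < i" by linarith
    then show "hrows M u (x # xs) i l = (if i \<in> ?A then (\<lambda>l. a i * Z p i l + 1 * Z p p l) else Z p i) l"
    proof cases
      case 1
      then show ?thesis using p by (simp add: hrows_def Z_def)
    next
      case 2
      then show ?thesis using p R_low[of p] by (simp add: hrows_def Z_def k_def)
    next
      case 3
      have "i - p = Suc (i - Suc p)" using 3 by simp
      then have "hrows M u (x # xs) i l = hvec (addx u (xs ! (i - Suc p))) (Suc k) l"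
        using 3 p unfolding hrows_def by (simp add: k_def)
      also have "\<dots> = a i * R i l + R p l"
        using hvec_addx_diff[of "Suc k" u "xs ! (i - Suc p)" l x] 3 p by (simp add: R_low R_high a_def)
      finally show ?thesis using 3 i by (simp add: Z_def)
    qed
  qed
  also have "\<dots> = prod a ?A * multisum S g M (Z p)"
    using p by (intro row_ops) auto
  also have "prod a ?A = (\<Prod>i = 0..<k. xz (xs ! i) - xz x)"
    unfolding a_def
    by (rule prod.reindex_bij_witness[of _ "\<lambda>i. i + Suc p" "\<lambda>i. i - Suc p"]) (use p in auto)
  also have "\<dots> = prod_list (map (\<lambda>y. xz y - xz x) xs)"
    by (simp add: prod.list_conv_set_nth k_def)
  also have "multisum S g M (Z p) = multisum S g M (Z 0)"
  proof -
    have "multisum S g M (Z t) = multisum S g M (Z 0)" if "t \<le> p" for t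
      using that
    proof (induction t)
      case (Suc t)
      \<comment> \<open>Row \<open>Suc t\<close> of \<open>Z t\<close> still belongs to
        \<open>addx u x\<close>, so the correction term of \<open>hvec_addx\<close> is a multiple of
        an actual row of \<open>Z t\<close>.\<close>
      have "Z (Suc t) i l = ((Z t)(t := \<lambda>l. 1 * Z t t l + - xz x * Z t (Suc t) l)) i l" for i l
      proof (cases i t rule: linorder_cases)
        case equal
        have "hvec u (M - t) l = R t l - xz x * R (Suc t) l"
          using Suc.prems p hvec_addx[of "M - t" u l x] by (simp add: R_low)
        then show ?thesis using equal by (simp add: Z_def)
      qed (simp_all add: Z_def)
      then have eq: "Z (Suc t) = (Z t)(t := \<lambda>l. 1 * Z t t l + - xz x * Z t (Suc t) l)" by (intro ext)
      have "multisum S g M (Z (Suc t)) = 1 * multisum S g M (Z t)"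
        unfolding eq by (rule row_op) (use Suc.prems p(1) in simp_all)
      moreover have "multisum S g M (Z t) = multisum S g M (Z 0)"
        using Suc.prems by (intro Suc.IH) simp
      ultimately show ?case by (simp only: mult_1)
    qed simp
    then show ?thesis by blast
  qed
  also have "Z 0 = R" by (simp add: Z_def)
  finally show ?thesis unfolding R_def .
qed

lemma multisum_hrows:
  fixes g :: "int list \<Rightarrow> pser"
  assumes "alternating_sum S g" and "length xs \<le> M"
  shows "multisum S g M (hrows M u xs) =
    pairprod (\<lambda>x y. xz y - xz x) xs * multisum S g M (\<lambda>i. hvec (foldl addx u xs) (M - i))"
  using assms(2)
proof (induction xs arbitrary: u)
  case Nil
  show ?case by (simp, rule multisum_cong) (simp add: hrows_def)
next
  case (Cons x xs)
  then show ?case using hrows_Cons[OF assms(1), of xs M u x] by simp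
qed

lemma pser_eq_uminus_imp_zero: "x = - x \<Longrightarrow> x = (0 :: pser)"
proof (rule fps_ext, rule poly_mapping_eqI)
  fix d m assume "x = - x"
  then have "Poly_Mapping.lookup (fps_nth x d) m = - Poly_Mapping.lookup (fps_nth x d) m"
    by (metis fps_neg_nth lookup_uminus)
  then show "Poly_Mapping.lookup (fps_nth x d) m = Poly_Mapping.lookup (fps_nth 0 d) m" by simp
qed

lemma fconst_uminus: "fconst (- c) = - fconst c"
  by (simp add: fconst_def pconst_uminus flip: fps_const_neg)

lemma alternating_sum_ptil: "alternating_sum (box M) (\<lambda>ls. fconst (ptil w ls))"
  by unfold_locales (auto simp: box_def ptil_swap fconst_uminus dest: pser_eq_uminus_imp_zero)

section \<open>The quadratic relation for the tau function\<close>

lemma pluecker_form_alt: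
  "pluecker_form phi I J =
    - (\<Sum>j<length J. (-1) ^ j * ptil phi (I @ [J ! j]) * ptil phi (take j J @ drop (Suc j) J))"
  unfolding pluecker_form_def sum_negf[symmetric]
proof (rule sum.reindex_bij_witness[of _ Suc "\<lambda>j. j - 1"])
  fix j assume "j \<in> {1..length J}"
  then show "- ((-1) ^ (j - 1) * ptil phi (I @ [J ! (j - 1)]) * ptil phi (take (j - 1) J @ drop (Suc (j - 1)) J))
    = (-1) ^ j * ptil phi (I @ [J ! (j - 1)]) * ptil phi (take (j - 1) J @ drop j J)"
    by (cases j) auto
qed auto

lemma multisum_hrows_pluecker:
  assumes "is_grpoint w" "length I = m" "length J = Suc (Suc m)" "Suc m \<le> M"
  shows "(\<Sum>j<Suc (Suc m). (-1) ^ j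
      * multisum (box M) (\<lambda>ls. fconst (ptil w ls)) M (hrows M u (I @ [J ! j]))
      * multisum (box M) (\<lambda>ls. fconst (ptil w ls)) M (hrows M u (take j J @ drop (Suc j) J))) = 0"
proof -
  interpret alternating_sum "box M" "\<lambda>ls. fconst (ptil w ls)" by (rule alternating_sum_ptil)
  interpret c: coeff_hom fconst by (rule coeff_hom_fconst)
  let ?F = "multisum (box M) (\<lambda>ls. fconst (ptil w ls)) M"
  obtain m' where M: "M = Suc m'" using assms(4) by (cases M) auto
  define q where "q = M - Suc m"
  have q: "q + Suc m = M" using assms(4) by (simp add: q_def)
  \<comment> \<open>The level is \<open>Suc m\<close> although \<open>I\<close> and \<open>J\<close>
    have lengths \<open>m\<close> and \<open>Suc (Suc m)\<close>: after an exchange both lists have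
    length \<open>Suc m\<close>, the level prescribed by \<open>hrows\<close>.\<close>
  define row where "row L i = (if i < q then hvec u (M - i) else hvec (addx u (L ! (i - q))) (Suc m))" for L i
  have sign: "fconst ((-1) ^ j) = (-1) ^ j" for j
    by (induction j) (simp_all add: fconst_uminus c.c1)
  have sum: "fconst (sum f A) = (\<Sum>i\<in>A. fconst (f i))" for f and A :: "nat set"
    by (induction A rule: infinite_finite_induct) (simp_all add: c.c0 c.c_add)
  have rel: "(\<Sum>j<Suc M. (-1) ^ j * ?F (\<lambda>i. if i < m' then row I i else row J j)
    * ?F (\<lambda>i. row J (skip j i))) = 0"
    unfolding M
  proof (rule multisum_pluecker)
    fix "is" js
    assume t: "is \<in> tuples (box (Suc m')) m'" "js \<in> tuples (box (Suc m')) (Suc (Suc m'))"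
    \<comment> \<open>The box is exactly the range of entries for \<open>k = M\<close> and
      \<open>N = 2 * M\<close>.\<close>
    have "pluecker_form w is js = 0"
      by (rule is_grpoint_pluecker[OF assms(1), of "Suc m'" "2 * Suc m'"]) (use t in \<open>auto simp: tuples_def box_def\<close>)
    then have "(\<Sum>j<Suc (Suc m'). (-1) ^ j * ptil w (is @ [js ! j]) * ptil w (take j js @ drop (Suc j) js)) = 0"
      using t(2) unfolding pluecker_form_alt by (simp add: tuples_def del: sum.lessThan_Suc)
    then have "fconst (\<Sum>j<Suc (Suc m'). (-1) ^ j * ptil w (is @ [js ! j]) * ptil w (take j js @ drop (Suc j) js)) = 0"
      by (simp only: c.c0)
    then show "(\<Sum>j<Suc (Suc m'). (-1) ^ j * fconst (ptil w (is @ [js ! j])) * fconst (ptil w (take j js @ drop (Suc j) js))) = 0"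
      by (simp only: sum c.c_mult sign)
  qed (simp add: box_def)
  \<comment> \<open>For \<open>b < q\<close> the row does not depend on the list, and it already
    stands among the first \<open>m'\<close> arguments.\<close>
  have zero: "?F (\<lambda>i. if i < m' then row I i else row J b) = 0" if "b < q" for b
  proof (rule alternating[of b M m'])
    have "b < m'" using that q M by simp
    then show "(if b < m' then row I b else row J b) = (if m' < m' then row I m' else row J b)"
      using that by (simp add: row_def)
  qed (use that q M in auto)
  have first: "?F (\<lambda>i. if i < m' then row I i else row J (q + j)) = ?F (hrows M u (I @ [J ! j]))"
    if "j < Suc (Suc m)" for j
  proof (rule multisum_cong)
    fix i l assume "i < M"
    have "M - Suc m = q" using q by simp
    moreover have "i = m' \<or> i < m'" using \<open>i < M\<close> M by auto
    moreover have "i < q \<or> (i - q < m \<longleftrightarrow> i < m')" using \<open>i < M\<close> M q by auto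
    moreover have "m' - q = m" "\<not> m' < q" using M q by auto
    ultimately show "(if i < m' then row I i else row J (q + j)) l = hrows M u (I @ [J ! j]) i l"
      using assms(2) by (auto simp: row_def hrows_def nth_append)
  qed
  have second: "?F (\<lambda>i. row J (skip (q + j) i)) = ?F (hrows M u (take j J @ drop (Suc j) J))"
    if "j < Suc (Suc m)" for j
  proof (rule multisum_cong)
    fix i l assume "i < M"
    have len: "length (take j J @ drop (Suc j) J) = Suc m" using assms(3) that by simp
    have nth: "(take j J @ drop (Suc j) J) ! i' = J ! skip j i'" if "i' < Suc m" for i'
      using that \<open>j < Suc (Suc m)\<close> assms(3) by (intro nth_skip) auto
    have "M - Suc m = q" using q by simp
    moreover have "skip (q + j) i = q + skip j (i - q)" if "q \<le> i" using that by (auto simp: skip_def)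
    moreover have "skip (q + j) i = i" if "i < q" using that by (auto simp: skip_def)
    ultimately show "row J (skip (q + j) i) l = hrows M u (take j J @ drop (Suc j) J) i l"
      using \<open>i < M\<close> q unfolding row_def hrows_def len by (cases "i < q") (auto simp: nth)
  qed
  have "(\<Sum>b<Suc M. (-1) ^ b * ?F (\<lambda>i. if i < m' then row I i else row J b) * ?F (\<lambda>i. row J (skip b i)))
    = (\<Sum>b\<in>{q..<Suc M}. (-1) ^ b * ?F (\<lambda>i. if i < m' then row I i else row J b) * ?F (\<lambda>i. row J (skip b i)))"
  proof (intro sum.mono_neutral_right ballI)
    fix b assume "b \<in> {..<Suc M} - {q..<Suc M}"
    then have "b < q" by auto
    then show "(-1) ^ b * ?F (\<lambda>i. if i < m' then row I i else row J b) * ?F (\<lambda>i. row J (skip b i)) = 0"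
      by (simp only: zero mult_zero_left mult_zero_right)
  qed auto
  also have "\<dots> = (\<Sum>j<Suc (Suc m). (-1) ^ (q + j) * ?F (\<lambda>i. if i < m' then row I i else row J (q + j))
      * ?F (\<lambda>i. row J (skip (q + j) i)))"
  proof (rule sum.reindex_bij_witness[of _ "\<lambda>j. q + j" "\<lambda>b. b - q"])
    fix b assume "b \<in> {q..<Suc M}"
    then have b: "q + (b - q) = b" by simp
    show "(-1) ^ (q + (b - q)) * ?F (\<lambda>i. if i < m' then row I i else row J (q + (b - q)))
        * ?F (\<lambda>i. row J (skip (q + (b - q)) i))
      = (-1) ^ b * ?F (\<lambda>i. if i < m' then row I i else row J b) * ?F (\<lambda>i. row J (skip b i))"
      unfolding b ..
  qed (use q in auto)
  also have "\<dots> = (-1) ^ q * (\<Sum>j<Suc (Suc m). (-1) ^ j * ?F (hrows M u (I @ [J ! j]))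
      * ?F (hrows M u (take j J @ drop (Suc j) J)))"
    unfolding sum_distrib_left by (intro sum.cong refl) (simp only: first second lessThan_iff power_add mult.assoc)
  finally have "(-1) ^ q * (\<Sum>j<Suc (Suc m). (-1) ^ j * ?F (hrows M u (I @ [J ! j]))
      * ?F (hrows M u (take j J @ drop (Suc j) J))) = 0" by (simp only: rel)
  moreover have "(-1 :: pser) ^ q \<noteq> 0" by simp
  ultimately show ?thesis by (simp only: mult_eq_0_iff simp_thms)
qed

definition vdm_tau :: "(partition \<Rightarrow> complex) \<Rightarrow> (nat \<Rightarrow> poly) \<Rightarrow> int list \<Rightarrow> pser" where
  "vdm_tau w u L = pairprod xdiff L * tau w (foldl addx u L)"

text \<open>Row operations produce the factors \<open>xz y - xz x\<close>, the negatives of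
  \<open>xdiff x y\<close>. The sign is left implicit: it depends on the length alone, so it is
  common to both factors of each term and squares to 1.\<close>

lemma pairprod_uminus: "\<exists>e\<in>{1, -1}. \<forall>L. length L = k \<longrightarrow> pairprod (\<lambda>x y. - f x y) L = e * pairprod f L"
proof (induction k)
  case 0
  then show ?case by auto
next
  case (Suc k)
  then obtain e where e: "e \<in> {1, -1}" "\<And>L. length L = k \<Longrightarrow> pairprod (\<lambda>x y. - f x y) L = e * pairprod f L"
    by blast
  have neg: "prod_list (map (\<lambda>y. - f x y) ys) = (-1) ^ length ys * prod_list (map (f x) ys)" for x ys
    by (induction ys) simp_all
  have "pairprod (\<lambda>x y. - f x y) L = ((-1) ^ k * e) * pairprod f L" if "length L = Suc k" for L
    using that e(2) by (cases L) (auto simp: neg mult_ac)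
  moreover have "(-1) ^ k * e \<in> {1, -1}" using e(1) by (cases "even k") auto
  ultimately show ?case by blast
qed

lemma tau_bilinear:
  assumes "is_grpoint w" "length I = m" "length J = Suc (Suc m)"
  shows "(\<Sum>j<Suc (Suc m). (-1) ^ j * vdm_tau w u (I @ [J ! j]) * vdm_tau w u (take j J @ drop (Suc j) J)) = 0"
proof -
  let ?P = "\<Sum>j<Suc (Suc m). (-1) ^ j * vdm_tau w u (I @ [J ! j]) * vdm_tau w u (take j J @ drop (Suc j) J)"
  obtain e where "e \<in> {1, -1}"
    and e: "\<And>L. length L = Suc m \<Longrightarrow> pairprod (\<lambda>x y. - xdiff x y) L = e * pairprod xdiff L"
    using pairprod_uminus[of "Suc m" xdiff] by blast
  then have ee: "e * e = 1" by auto
  have "fps_nth ?P d = 0" for d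
  proof -
    \<comment> \<open>\<open>d \<le> M\<close> makes the truncation exact at the coefficient
      \<open>d\<close>, and \<open>Suc m \<le> M\<close> leaves room for the rows of the
      entries.\<close>
    define M where "M = max d (Suc m)"
    let ?F = "multisum (box M) (\<lambda>ls. fconst (ptil w ls)) M"
    \<comment> \<open>Congruence modulo \<open>fps_X ^ Suc M\<close>, hence compatible with
      products.\<close>
    define agree :: "pser \<Rightarrow> pser \<Rightarrow> bool" where "agree A B \<longleftrightarrow> (\<forall>d\<le>M. fps_nth A d = fps_nth B d)" for A B
    have agree_mult: "agree (A * C) (B * D)" if "agree A B" "agree C D" for A B C D
      using that unfolding agree_def by (auto simp: fps_mult_nth intro!: sum.cong)
    have agree_refl: "agree A A" for A by (simp add: agree_def)
    have F: "agree (?F (hrows M u L)) (e * vdm_tau w u L)" if "length L = Suc m" for L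
    proof -
      have "agree (?F (\<lambda>i. hvec (foldl addx u L) (M - i))) (tau w (foldl addx u L))"
        by (simp add: agree_def multisum_tau)
      moreover have "?F (hrows M u L) = (e * pairprod xdiff L) * ?F (\<lambda>i. hvec (foldl addx u L) (M - i))"
        using multisum_hrows[OF alternating_sum_ptil, of L M] e[OF that] that
        by (simp add: xdiff_xz M_def)
      ultimately show ?thesis
        unfolding vdm_tau_def by (simp only: mult.assoc[symmetric]) (intro agree_mult agree_refl)
    qed
    have "agree ((-1) ^ j * ?F (hrows M u (I @ [J ! j])) * ?F (hrows M u (take j J @ drop (Suc j) J)))
        ((-1) ^ j * vdm_tau w u (I @ [J ! j]) * vdm_tau w u (take j J @ drop (Suc j) J))"
      if "j < Suc (Suc m)" for j
    proof -
      have "agree ((-1) ^ j * ?F (hrows M u (I @ [J ! j])) * ?F (hrows M u (take j J @ drop (Suc j) J)))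
        ((-1) ^ j * (e * vdm_tau w u (I @ [J ! j])) * (e * vdm_tau w u (take j J @ drop (Suc j) J)))"
        using that assms(2,3) by (intro agree_mult agree_refl F) auto
      also have "(-1) ^ j * (e * A) * (e * B) = (-1) ^ j * A * B" for A B
        by (simp only: mult_ac) (simp add: ee flip: mult.assoc)
      finally show ?thesis .
    qed
    then have "agree (\<Sum>j<Suc (Suc m). (-1) ^ j * ?F (hrows M u (I @ [J ! j])) * ?F (hrows M u (take j J @ drop (Suc j) J))) ?P"
      unfolding agree_def fps_sum_nth by (auto intro!: sum.cong)
    moreover have "(\<Sum>j<Suc (Suc m). (-1) ^ j * ?F (hrows M u (I @ [J ! j])) * ?F (hrows M u (take j J @ drop (Suc j) J))) = 0"
      using assms by (intro multisum_hrows_pluecker) (auto simp: M_def)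
    ultimately have "agree 0 ?P" by (simp only:)
    moreover have "d \<le> M" by (simp add: M_def)
    ultimately have "fps_nth 0 d = fps_nth ?P d" unfolding agree_def by blast
    then show ?thesis by (simp only: fps_zero_nth)
  qed
  then show ?thesis by (intro fps_ext) (simp only: fps_zero_nth)
qed

section \<open>The localization\<close>

definition homog :: "nat \<Rightarrow> poly set" where
  "homog d = {p. \<forall>mo\<in>Poly_Mapping.keys p. wdeg mo = d \<and> Poly_Mapping.lookup mo (T 0) = 0}"

lemma Cxt_homog: "F \<in> Cxt \<longleftrightarrow> (\<forall>d. fps_nth F d \<in> homog d)"
  by (simp add: Cxt_def homog_def)

lemma wdeg_superset:
  assumes "finite A" "Poly_Mapping.keys m \<subseteq> A"
  shows "wdeg m = (\<Sum>v\<in>A. Poly_Mapping.lookup m v * vweight v)"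
  unfolding wdeg_def
  by (rule sum.mono_neutral_left) (use assms in \<open>auto simp: in_keys_iff\<close>)

lemma wdeg_add: "wdeg (m + m') = wdeg m + wdeg m'"
proof -
  let ?A = "Poly_Mapping.keys m \<union> Poly_Mapping.keys m'"
  have "Poly_Mapping.keys (m + m') \<subseteq> ?A" by (rule keys_add)
  then show ?thesis
    by (simp add: wdeg_superset[of ?A] lookup_add distrib_right sum.distrib)
qed

lemma homog_zero: "0 \<in> homog d"
  by (simp add: homog_def)

lemma homog_add: "p \<in> homog d \<Longrightarrow> q \<in> homog d \<Longrightarrow> p + q \<in> homog d"
  unfolding homog_def using keys_add[of p q] by blast

lemma homog_uminus: "p \<in> homog d \<Longrightarrow> - p \<in> homog d"
  by (simp add: homog_def)

lemma homog_mult: "p \<in> homog d \<Longrightarrow> q \<in> homog e \<Longrightarrow> p * q \<in> homog (d + e)"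
  unfolding homog_def using keys_mult[of p q] by (fastforce simp: wdeg_add lookup_add)

lemma homog_pconst: "pconst c \<in> homog 0"
  by (simp add: homog_def pconst_def wdeg_def)

lemma homog_one: "1 \<in> homog 0"
  using homog_pconst[of 1] by simp

lemma homog_of_int: "of_int k \<in> homog 0"
  using homog_pconst[of "of_int k"] by (simp only: pconst_of_int)

lemma homog_sum: "(\<And>i. i \<in> A \<Longrightarrow> f i \<in> homog d) \<Longrightarrow> sum f A \<in> homog d"
  by (induction A rule: infinite_finite_induct) (simp_all add: homog_zero homog_add)

lemma homog_prod: "(\<And>i. i \<in> A \<Longrightarrow> f i \<in> homog (d i)) \<Longrightarrow> prod f A \<in> homog (sum d A)"
  by (induction A rule: infinite_finite_induct) (simp_all add: homog_one homog_mult)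

lemma homog_power: "p \<in> homog d \<Longrightarrow> p ^ n \<in> homog (n * d)"
  by (induction n) (simp_all add: homog_one homog_mult)

lemma homog_pvar: "v \<noteq> T 0 \<Longrightarrow> pvar v \<in> homog (vweight v)"
  by (auto simp: homog_def pvar_def wdeg_def lookup_single)

lemma homog_hcomp:
  assumes "\<And>j. 0 < j \<Longrightarrow> u j \<in> homog j"
  shows "hcomp u k \<in> homog (nat k)"
proof (cases "k < 0")
  case False
  have "exp_term u (nat k) m \<in> homog (nat k)" if "m \<in> weighted (nat k) (nat k)" for m
  proof -
    have "exp_term u (nat k) m \<in> homog (\<Sum>j = 1..nat k. 0 + m j * j)"
      unfolding exp_term_def
      by (intro homog_prod homog_mult homog_pconst homog_power assms) simp
    also have "(\<Sum>j = 1..nat k. 0 + m j * j) = nat k"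
      using that by (simp add: weighted_def mult.commute)
    finally show ?thesis .
  qed
  then show ?thesis
    using hcomp_weighted[of "nat k" "nat k" u] False by (simp add: homog_sum)
qed (simp add: homog_zero)

lemma homog_schur:
  assumes "\<And>j. 0 < j \<Longrightarrow> u j \<in> homog j"
  shows "schur u la \<in> homog (psize la)"
  unfolding schur_extend[OF order.refl]
proof (rule homog_sum)
  let ?M = "length (parts la)"
  fix \<sigma> assume "\<sigma> \<in> {\<sigma>. \<sigma> permutes {1..?M}}"
  then have \<sigma>: "\<sigma> permutes {1..?M}" by simp
  let ?e = "\<lambda>i. int (part la i) - int i + int (\<sigma> i)"
  have "(\<Prod>i = 1..?M. hcomp u (?e i)) \<in> homog (psize la)"
  proof (cases "\<exists>i\<in>{1..?M}. ?e i < 0")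
    case True
    then obtain i where i: "i \<in> {1..?M}" "?e i < 0" by blast
    then have "(\<Prod>i = 1..?M. hcomp u (?e i)) = 0" by (intro prod_zero finite_atLeastAtMost bexI[of _ i]) simp_all
    then show ?thesis by (simp only: homog_zero)
  next
    case False
    then have "(\<Sum>i = 1..?M. nat (?e i)) = psize la"
      by (intro sum_nat_shift \<sigma> order.refl) (meson linorder_not_less)
    moreover have "(\<Prod>i = 1..?M. hcomp u (?e i)) \<in> homog (\<Sum>i = 1..?M. nat (?e i))"
      by (intro homog_prod homog_hcomp assms)
    ultimately show ?thesis by (simp only:)
  qed
  from homog_mult[OF homog_of_int this, of "sign \<sigma>"]
  show "of_int (sign \<sigma>) * (\<Prod>i = 1..?M. hcomp u (?e i)) \<in> homog (psize la)"
    by (simp only: add_0)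
qed

lemma homog_ushift: "0 < j \<Longrightarrow> ushift m j \<in> homog j"
proof -
  assume j: "0 < j"
  have "pvar (X i) ^ j \<in> homog j" for i
    using homog_power[OF homog_pvar[of "X i"], of j] by simp
  then have "pconst c * pvar (X i) ^ j \<in> homog j" for c i
    using homog_mult[OF homog_pconst, of "pvar (X i) ^ j" j c] by simp
  moreover have "pvar (T j) \<in> homog j" using homog_pvar[of "T j"] j by simp
  ultimately show ?thesis unfolding ushift_def by (intro homog_add homog_sum)
qed

lemma tau_shift_Cxt: "tau_shift w m \<in> Cxt"
  unfolding Cxt_homog tau_shift_def
  using homog_mult[OF homog_pconst homog_schur[of "ushift m", OF homog_ushift]]
  by (auto intro!: homog_sum)

lemma Cxt_zero: "0 \<in> Cxt" and Cxt_one: "1 \<in> Cxt"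
  by (auto simp: Cxt_homog homog_zero homog_one)

lemma Cxt_add: "F \<in> Cxt \<Longrightarrow> G \<in> Cxt \<Longrightarrow> F + G \<in> Cxt"
  by (simp add: Cxt_homog homog_add)

lemma Cxt_mult: "F \<in> Cxt \<Longrightarrow> G \<in> Cxt \<Longrightarrow> F * G \<in> Cxt"
  unfolding Cxt_homog fps_mult_nth
proof (intro allI homog_sum)
  fix d i :: nat assume "\<forall>d. fps_nth F d \<in> homog d" "\<forall>d. fps_nth G d \<in> homog d" "i \<in> {0..d}"
  then show "fps_nth F i * fps_nth G (d - i) \<in> homog d"
    using homog_mult[of "fps_nth F i" i "fps_nth G (d - i)" "d - i"] by simp
qed

lemma Cxt_const: "fps_const (pconst c) \<in> Cxt"
  by (simp add: Cxt_homog homog_pconst homog_zero)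

lemma Cxt_xdiff: "xdiff i j \<in> Cxt"
  unfolding Cxt_homog
proof
  fix d
  have "pvar (X k) \<in> homog 1" for k using homog_pvar[of "X k"] by simp
  then have "pvar (X i) - pvar (X j) \<in> homog 1"
    using homog_add[of "pvar (X i)" 1 "- pvar (X j)"] homog_uminus by simp
  then show "fps_nth (xdiff i j) d \<in> homog d"
    by (cases "d = 1") (simp_all add: xdiff_def homog_zero)
qed

section \<open>Denominators and the localized ring\<close>

lemma xdiff_nonzero:
  assumes "i \<noteq> j"
  shows "xdiff i j \<noteq> 0"
proof -
  have "Poly_Mapping.lookup (pvar (X i) - pvar (X j)) (Poly_Mapping.single (X i) 1) = 1"
    using assms by (auto simp: pvar_def lookup_minus lookup_single when_def dest!: arg_cong[of _ _ Poly_Mapping.keys])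
  then have "fps_nth (xdiff i j) 1 \<noteq> 0" by (auto simp: xdiff_def)
  then show ?thesis by auto
qed

lemma Smult_mult: "s \<in> Smult \<Longrightarrow> t \<in> Smult \<Longrightarrow> s * t \<in> Smult"
  by (induction rule: Smult.induct) (auto simp: mult.assoc intro: Smult.step)

lemma Smult_Cxt: "s \<in> Smult \<Longrightarrow> s \<in> Cxt"
  by (induction rule: Smult.induct) (simp_all add: Cxt_one Cxt_mult Cxt_xdiff)

lemma Smult_nonzero: "s \<in> Smult \<Longrightarrow> s \<noteq> 0"
  by (induction rule: Smult.induct) (simp_all add: xdiff_nonzero)

lemma Loc_Cxt: "a \<in> Cxt \<Longrightarrow> Fract a 1 \<in> Loc"
  unfolding Loc_def using Smult.one by blast

lemma Loc_add: "x \<in> Loc \<Longrightarrow> y \<in> Loc \<Longrightarrow> x + y \<in> Loc"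
proof -
  assume "x \<in> Loc" "y \<in> Loc"
  then obtain a s b t where x: "x = Fract a s" "a \<in> Cxt" "s \<in> Smult" and y: "y = Fract b t" "b \<in> Cxt" "t \<in> Smult"
    unfolding Loc_def by blast
  then have "x + y = Fract (a * t + b * s) (s * t)" by (simp add: Smult_nonzero)
  moreover have "a * t + b * s \<in> Cxt" using x y by (simp add: Cxt_add Cxt_mult Smult_Cxt)
  ultimately show ?thesis unfolding Loc_def using Smult_mult x y by blast
qed

lemma Loc_mult: "x \<in> Loc \<Longrightarrow> y \<in> Loc \<Longrightarrow> x * y \<in> Loc"
proof -
  assume "x \<in> Loc" "y \<in> Loc"
  then obtain a s b t where x: "x = Fract a s" "a \<in> Cxt" "s \<in> Smult" and y: "y = Fract b t" "b \<in> Cxt" "t \<in> Smult"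
    unfolding Loc_def by blast
  then have "x * y = Fract (a * b) (s * t)" by simp
  then show ?thesis unfolding Loc_def using Smult_mult Cxt_mult x y by blast
qed

lemma Loc_zero: "0 \<in> Loc" and Loc_one: "1 \<in> Loc"
  using Loc_Cxt[OF Cxt_zero] Loc_Cxt[OF Cxt_one] by (simp_all add: Zero_fract_def One_fract_def)

lemma Loc_sum: "(\<And>i. i \<in> A \<Longrightarrow> f i \<in> Loc) \<Longrightarrow> sum f A \<in> Loc"
  by (induction A rule: infinite_finite_induct) (simp_all add: Loc_zero Loc_add)

lemma Loc_prod: "(\<And>i. i \<in> A \<Longrightarrow> f i \<in> Loc) \<Longrightarrow> prod f A \<in> Loc"
  by (induction A rule: infinite_finite_induct) (simp_all add: Loc_one Loc_mult)

lemma Loc_power: "x \<in> Loc \<Longrightarrow> x ^ n \<in> Loc"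
  by (induction n) (simp_all add: Loc_one Loc_mult)

text \<open>Negative exponents occur when two lattice coordinates have opposite signs; they stay in
  \<open>Loc\<close> because \<open>xdiff i j\<close> itself belongs to
  \<open>Smult\<close>.\<close>

lemma Loc_xdiff_powi:
  assumes "i \<noteq> j"
  shows "Fract (xdiff i j) 1 powi n \<in> Loc"
proof -
  have "xdiff i j \<in> Smult" using Smult.step[OF assms Smult.one] by simp
  then have "inverse (Fract (xdiff i j) 1) \<in> Loc" unfolding Loc_def using Cxt_one by auto
  moreover have "Fract (xdiff i j) 1 \<in> Loc" by (intro Loc_Cxt Cxt_xdiff)
  ultimately show ?thesis by (simp add: power_int_def Loc_power)
qed

lemma Loc_Hfun: "Hfun w m \<in> Loc"
  unfolding Hfun_def by (auto intro!: Loc_mult Loc_prod Loc_xdiff_powi Loc_Cxt tau_shift_Cxt)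

lemma Loc_Phi: "Phi w n q \<in> Loc"
  unfolding Phi_def seval_def Hfun_lam_def
  by (intro Loc_sum Loc_mult Loc_prod Loc_power Loc_Hfun Loc_Cxt Cxt_const)

section \<open>Frobenius coordinates and lattice shifts\<close>

lemma initial_segment:
  fixes S :: "nat set"
  assumes "finite S" "0 \<notin> S" "\<And>i j. j \<in> S \<Longrightarrow> 1 \<le> i \<Longrightarrow> i \<le> j \<Longrightarrow> i \<in> S"
  shows "S = {1..card S}"
proof (cases "S = {}")
  case False
  have "S = {1..Max S}"
  proof (intro set_eqI iffI)
    fix i assume "i \<in> S"
    then show "i \<in> {1..Max S}" using assms(1,2) by (cases i) auto
  next
    fix i assume "i \<in> {1..Max S}"
    then show "i \<in> S" using assms(3)[OF Max_in[OF assms(1) False]] by auto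
  qed
  then show ?thesis by (metis card_atLeastAtMost diff_Suc_1)
qed simp

lemma frob_rank_set: "{i. 1 \<le> i \<and> i \<le> part la i} = {1..frob_rank la}"
  unfolding frob_rank_def
proof (rule initial_segment)
  have "{i. 1 \<le> i \<and> i \<le> part la i} \<subseteq> {..psize la}"
    using part_le_psize[of la] by (auto intro: order.trans)
  then show "finite {i. 1 \<le> i \<and> i \<le> part la i}" using finite_subset by blast
next
  fix i j assume "j \<in> {i. 1 \<le> i \<and> i \<le> part la i}" "1 \<le> i" "i \<le> j"
  then show "i \<in> {i. 1 \<le> i \<and> i \<le> part la i}" using part_antimono[of i j la] by simp
qed simp

text \<open>Parts decrease, so the rows reaching column \<open>i\<close> form an initial segment,
  and its cardinality is its last row.\<close>

lemma le_conj_part_iff: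
  assumes "1 \<le> i" "1 \<le> j"
  shows "j \<le> conj_part la i \<longleftrightarrow> i \<le> part la j"
proof -
  have "{j. 1 \<le> j \<and> j \<le> length (parts la) \<and> i \<le> part la j} = {1..conj_part la i}"
    unfolding conj_part_def
  proof (rule initial_segment)
    fix i' j assume "j \<in> {j. 1 \<le> j \<and> j \<le> length (parts la) \<and> i \<le> part la j}" "1 \<le> i'" "i' \<le> j"
    then show "i' \<in> {j. 1 \<le> j \<and> j \<le> length (parts la) \<and> i \<le> part la j}"
      using part_antimono[of i' j la] by simp
  qed auto
  then have "j \<in> {1..conj_part la i} \<longleftrightarrow> j \<le> length (parts la) \<and> i \<le> part la j"
    using assms(2) by blast
  moreover have "j \<le> length (parts la)" if "i \<le> part la j"
    using that assms(1) part_beyond[of la j] by (cases "j \<le> length (parts la)") simp_all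
  ultimately show ?thesis using assms(2) by (simp only: atLeastAtMost_iff) blast
qed

text \<open>A row reaches the diagonal exactly when its index is nonnegative, and no such row lies
  beyond \<open>k\<close>, where the parts are 0.\<close>

lemma frob_a_image:
  assumes "length (parts la) \<le> k"
  shows "frob_a la ` {1..frob_rank la} = set (beta k la) \<inter> {0..}"
proof -
  have "i \<le> k" if "1 \<le> i" "i \<le> part la i" for i
    using that assms part_beyond[of la i] by (cases "i \<le> length (parts la)") auto
  then have "{i. 1 \<le> i \<and> i \<le> part la i} = {i \<in> {1..<Suc k}. 0 \<le> int (part la i) - int i}"
    by (auto simp: less_Suc_eq_le)
  then have "frob_a la ` {1..frob_rank la} =
      (\<lambda>i. int (part la i) - int i) ` {i \<in> {1..<Suc k}. 0 \<le> int (part la i) - int i}"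
    unfolding frob_rank_set[symmetric] by (simp only: frob_a_def[abs_def])
  also have "\<dots> = set (beta k la) \<inter> {0..}"
    unfolding beta_def set_map set_upt by blast
  finally show ?thesis .
qed

lemma inj_on_frob_a: "inj_on (frob_a la) {1..frob_rank la}"
proof (rule linorder_inj_onI)
  fix i j assume "i < j" "i \<in> {1..frob_rank la}"
  then show "frob_a la i \<noteq> frob_a la j" using part_antimono[of i j la] by (simp add: frob_a_def)
qed auto

lemma inj_on_frob_b: "inj_on (\<lambda>i. - frob_b la i - 1) {1..frob_rank la}"
proof (rule linorder_inj_onI)
  fix i j assume ij: "i < j" "i \<in> {1..frob_rank la}"
  have "conj_part la j \<le> conj_part la i"
  proof (cases "conj_part la j = 0")
    case False
    then show ?thesis
      using le_conj_part_iff[of j "conj_part la j" la] le_conj_part_iff[of i "conj_part la j" la] ij by simp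
  qed simp
  then show "- frob_b la i - 1 \<noteq> - frob_b la j - 1" using ij by (simp add: frob_b_def)
qed auto

text \<open>With \<open>c = conj_part la i\<close>, the number \<open>i - 1 - c\<close> is no index
  \<open>part la j - j\<close>: for \<open>j \<le> c\<close> the part is at least \<open>i\<close>
  and the index too large, for \<open>j > c\<close> the part is below \<open>i\<close> and the index
  too small. Equality follows by counting: \<open>frob_rank la\<close> of the \<open>k\<close>
  indices are nonnegative, so equally many of the \<open>k\<close> negative places stay
  empty.\<close>

lemma frob_b_image:
  assumes "length (parts la) \<le> k"
  shows "(\<lambda>i. - frob_b la i - 1) ` {1..frob_rank la} = {- int k .. - 1} - set (beta k la)"
proof (rule card_subset_eq)
  show "(\<lambda>i. - frob_b la i - 1) ` {1..frob_rank la} \<subseteq> {- int k .. - 1} - set (beta k la)"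
  proof (intro image_subsetI)
    fix i assume "i \<in> {1..frob_rank la}"
    then have i: "1 \<le> i" "i \<le> part la i" unfolding frob_rank_set[symmetric] by auto
    define c where "c = conj_part la i"
    have "i \<le> c" using i by (simp add: c_def le_conj_part_iff)
    have "c \<le> k"
    proof (rule ccontr)
      assume "\<not> c \<le> k"
      then show False
        using le_conj_part_iff[of i c la] i part_beyond[of la c] assms by (simp add: c_def)
    qed
    have "int i - 1 - int c \<noteq> int (part la j) - int j" if "1 \<le> j" for j
      using le_conj_part_iff[OF i(1) that, of la] by (cases "j \<le> c") (auto simp: c_def)
    then have "int i - 1 - int c \<notin> set (beta k la)"
      unfolding beta_def set_map set_upt by (meson atLeastLessThan_iff imageE)
    moreover have "int i - 1 - int c \<in> {- int k .. - 1}" using \<open>i \<le> c\<close> \<open>c \<le> k\<close> i(1) by simp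
    moreover have "- frob_b la i - 1 = int i - 1 - int c" by (simp add: frob_b_def c_def)
    ultimately show "- frob_b la i - 1 \<in> {- int k .. - 1} - set (beta k la)" by (simp only: Diff_iff simp_thms)
  qed
  let ?B = "set (beta k la)"
  have "card ?B = k" using distinct_card[OF sorted_distinct_rev_beta(2), of k la] by simp
  moreover have "?B \<subseteq> {- int k..}"
    by (auto simp: beta_def simp del: upt_Suc)
  then have "?B = (?B \<inter> {0..}) \<union> ({- int k .. - 1} \<inter> ?B)" by auto
  then have "card ?B = card (?B \<inter> {0..}) + card ({- int k .. - 1} \<inter> ?B)"
    using card_Un_disjoint[of "?B \<inter> {0..}" "{- int k .. - 1} \<inter> ?B"] by force
  moreover have "card ({- int k .. - 1} - ?B) = k - card ({- int k .. - 1} \<inter> ?B)"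
    by (simp add: card_Diff_subset_Int)
  moreover have "card (?B \<inter> {0..}) = frob_rank la"
    using card_image[OF inj_on_frob_a[of la]] frob_a_image[OF assms] by simp
  ultimately show "card ((\<lambda>i. - frob_b la i - 1) ` {1..frob_rank la}) = card ({- int k .. - 1} - ?B)"
    unfolding card_image[OF inj_on_frob_b] by simp
qed simp

section \<open>Shifts of the lattice point\<close>

definition units :: "int set \<Rightarrow> int \<Rightarrow>\<^sub>0 int" where
  "units A = (\<Sum>l\<in>A. Poly_Mapping.single l 1)"

lemma lookup_units: "finite A \<Longrightarrow> Poly_Mapping.lookup (units A) i = (if i \<in> A then 1 else 0)"
  unfolding units_def
  by (induction A rule: finite_induct) (auto simp: lookup_add lookup_single when_def)

text \<open>Frobenius coordinates record only the change: negative entries of \<open>L\<close> are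
  present before and after, and cancel between the two \<open>units\<close>. In this form the
  removed set depends on \<open>L\<close> only through its length.\<close>

lemma frob_shift_lam_of:
  assumes "distinct L" "length L = k" "set L \<subseteq> {- int k..}"
  shows "frob_shift (lam_of L) = units (set L) - units {- int k .. - 1}"
proof -
  let ?la = "lam_of L" and ?s = "\<lambda>l. Poly_Mapping.single l (1::int)"
  have len: "length (parts ?la) \<le> k" using lam_of_beta(2)[OF assms] .
  have set: "set (beta k ?la) = set L" using mset_lam_of[OF assms] by (metis mset_eq_setD)
  have "frob_shift ?la = units (set L \<inter> {0..}) - units ({- int k .. - 1} - set L)"
    unfolding frob_shift_def sum_subtractf units_def set[symmetric]
      frob_a_image[OF len, symmetric] frob_b_image[OF len, symmetric]
      sum.reindex[OF inj_on_frob_a] sum.reindex[OF inj_on_frob_b] o_def ..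
  also have "\<dots> = units (set L) - units {- int k .. - 1}"
    using assms(3) by (intro poly_mapping_eqI) (auto simp: lookup_minus lookup_units)
  finally show ?thesis .
qed

lemma ushift_superset:
  assumes "finite A" "Poly_Mapping.keys m \<subseteq> A"
  shows "ushift m j = pvar (T j) + (\<Sum>i\<in>A. pconst (of_int (Poly_Mapping.lookup m i) / of_nat j) * pvar (X i) ^ j)"
  unfolding ushift_def
  by (rule arg_cong[of _ _ "(+) _"], rule sum.mono_neutral_left) (use assms in \<open>auto simp: in_keys_iff\<close>)

lemma ushift_add_single: "ushift (m + Poly_Mapping.single x 1) = addx (ushift m) x"
proof
  fix j
  let ?A = "insert x (Poly_Mapping.keys m)"
  have sub: "Poly_Mapping.keys (m + Poly_Mapping.single x 1) \<subseteq> ?A"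
    using keys_add[of m "Poly_Mapping.single x 1"] by auto
  have "pconst (of_int (Poly_Mapping.lookup (m + Poly_Mapping.single x 1) i) / of_nat j) * pvar (X i) ^ j =
      pconst (of_int (Poly_Mapping.lookup m i) / of_nat j) * pvar (X i) ^ j +
      (if i = x then pconst (1 / of_nat j) * pvar (X x) ^ j else 0)" for i
    by (auto simp: lookup_add lookup_single when_def add_divide_distrib pconst_add distrib_right)
  then show "ushift (m + Poly_Mapping.single x 1) j = addx (ushift m) x j"
    by (simp add: ushift_superset[of ?A] sub addx_def sum.distrib add.assoc)
      (simp add: ushift_superset[of ?A m] subset_insertI)
qed

lemma ushift_units:
  assumes "distinct L"
  shows "ushift (m + units (set L)) = foldl addx (ushift m) L"
  using assms
proof (induction L arbitrary: m)
  case (Cons x L)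
  then have eq: "m + units (set (x # L)) = (m + Poly_Mapping.single x 1) + units (set L)"
    by (simp add: units_def add.assoc)
  show ?case
    unfolding eq foldl.simps ushift_add_single[symmetric] by (rule Cons.IH) (use Cons.prems in simp)
qed (simp add: units_def)

lemma tau_shift_tau: "tau_shift w m = tau w (ushift m)"
  by (simp add: tau_shift_def tau_def)

section \<open>Passage to the fraction field and comparison of prefactors\<close>

definition fr :: "pser \<Rightarrow> pser fract" where
  "fr a = Fract a 1"

lemma fr_zero [simp]: "fr 0 = 0" and fr_one [simp]: "fr 1 = 1"
  and fr_add: "fr (a + b) = fr a + fr b" and fr_mult: "fr (a * b) = fr a * fr b"
  and fr_uminus: "fr (- a) = - fr a"
  by (simp_all add: fr_def Zero_fract_def One_fract_def)

lemma fr_sum: "fr (sum f A) = (\<Sum>i\<in>A. fr (f i))"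
  by (induction A rule: infinite_finite_induct) (simp_all add: fr_add)

lemma fr_sign: "fr ((-1) ^ j) = (-1) ^ j"
  by (induction j) (simp_all add: fr_mult fr_uminus)

lemma fr_prod_list: "fr (prod_list xs) = prod_list (map fr xs)"
  by (induction xs) (simp_all add: fr_mult)

lemma fr_pairprod: "fr (pairprod f xs) = pairprod (\<lambda>x y. fr (f x y)) xs"
  by (induction xs) (simp_all add: fr_mult fr_prod_list o_def)

lemma fr_xdiff_nonzero: "i \<noteq> j \<Longrightarrow> fr (xdiff i j) \<noteq> 0"
  by (simp add: fr_def Zero_fract_def eq_fract xdiff_nonzero)

lemma pairprod_sorted:
  assumes "sorted xs" "distinct xs"
  shows "(\<Prod>i\<in>set xs. \<Prod>j\<in>set xs. if i < j then f i j else 1) = pairprod f (xs :: int list)"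
  using assms
proof (induction xs)
  case (Cons x xs)
  have less: "x < y" if "y \<in> set xs" for y
    using Cons.prems that by (auto simp: less_le)
  have "(\<Prod>i\<in>set xs. \<Prod>j\<in>set (x # xs). if i < j then f i j else 1) =
      (\<Prod>i\<in>set xs. \<Prod>j\<in>set xs. if i < j then f i j else 1)"
  proof (rule prod.cong[OF refl])
    fix i assume "i \<in> set xs"
    then have "\<not> i < x" using less[of i] by simp
    then show "(\<Prod>j\<in>set (x # xs). if i < j then f i j else 1) = (\<Prod>j\<in>set xs. if i < j then f i j else 1)"
      using Cons.prems by simp
  qed
  moreover have "(\<Prod>j\<in>set (x # xs). if x < j then f x j else 1) = prod_list (map (f x) xs)"
    using Cons.prems less by (simp add: prod.distinct_set_conv_list[symmetric])
  ultimately show ?case using Cons by simp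
qed simp

text \<open>The mixed part of the exponents when a unit vector at \<open>l\<close> is added. There
  are two conditionals because differences are taken in increasing order of indices;
  \<open>i = l\<close> contributes 1.\<close>

definition gauge :: "int set \<Rightarrow> (int \<Rightarrow>\<^sub>0 int) \<Rightarrow> int \<Rightarrow> pser fract" where
  "gauge K m l = (\<Prod>i\<in>K. (if i < l then fr (xdiff i l) powi Poly_Mapping.lookup m i else 1) *
    (if l < i then fr (xdiff l i) powi Poly_Mapping.lookup m i else 1))"

text \<open>The product runs over a fixed \<open>K\<close> instead of the support, so that different
  lattice points can be compared; pairs off the support have exponent 0.\<close>

definition prefactor :: "int set \<Rightarrow> (int \<Rightarrow>\<^sub>0 int) \<Rightarrow> pser fract" where
  "prefactor K m = (\<Prod>i\<in>K. \<Prod>j\<in>K. if i < j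
    then fr (xdiff i j) powi (Poly_Mapping.lookup m i * Poly_Mapping.lookup m j) else 1)"

lemma Hfun_prefactor:
  assumes "finite K" "Poly_Mapping.keys m \<subseteq> K"
  shows "Hfun w m = prefactor K m * fr (tau w (ushift m))"
proof -
  let ?f = "\<lambda>i j. fr (xdiff i j) powi (Poly_Mapping.lookup m i * Poly_Mapping.lookup m j)"
  have "(\<Prod>(i, j)\<in>{(i, j). i \<in> Poly_Mapping.keys m \<and> j \<in> Poly_Mapping.keys m \<and> i < j}. ?f i j) =
      (\<Prod>(i, j)\<in>K \<times> K. if i < j then ?f i j else 1)"
    by (rule prod.mono_neutral_cong_left) (use assms in \<open>auto simp: in_keys_iff split: if_splits\<close>)
  then show ?thesis
    unfolding Hfun_def prefactor_def tau_shift_tau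
    by (simp add: prod.cartesian_product fr_def)
qed

text \<open>The factors depending on a single element of \<open>D\<close> act as a torus on the Pluecker coordinates,
  so they do not disturb the quadratic relations.\<close>

lemma prefactor_add_units:
  assumes "finite K" "D \<subseteq> K"
  shows "prefactor K (m + units D) = prefactor K m * (\<Prod>l\<in>D. gauge K m l) *
    (\<Prod>i\<in>D. \<Prod>j\<in>D. if i < j then fr (xdiff i j) else 1)"
proof -
  have fin: "finite D" using assms finite_subset by blast
  let ?X = "\<lambda>i j. fr (xdiff i j)" and ?m = "Poly_Mapping.lookup m"
  let ?d = "\<lambda>i. if i \<in> D then 1 else 0 :: int"
  let ?if = "\<lambda>i j x. if i < j then x else (1 :: pser fract)"
  \<comment> \<open>The four summands of \<open>(m i + d i) * (m j + d j)\<close>, where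
    \<open>d\<close> is the indicator of \<open>D\<close>. Splitting integer powers needs a nonzero
    base, which \<open>i < j\<close> provides.\<close>
  have split: "?if i j (?X i j powi (Poly_Mapping.lookup (m + units D) i * Poly_Mapping.lookup (m + units D) j)) =
      ?if i j (?X i j powi (?m i * ?m j)) * (if j \<in> D then ?if i j (?X i j powi ?m i) else 1) *
      (if i \<in> D then ?if i j (?X i j powi ?m j) else 1) *
      (if i \<in> D then if j \<in> D then ?if i j (?X i j) else 1 else 1)" for i j
  proof (cases "i < j")
    case True
    then have "?X i j \<noteq> 0" by (simp add: fr_xdiff_nonzero)
    then show ?thesis using True
      by (simp add: lookup_add lookup_units[OF fin] distrib_left distrib_right power_int_add mult_ac)
  qed simp
  have restrict: "(\<Prod>i\<in>K. if i \<in> D then f i else 1) = (\<Prod>i\<in>D. f i :: pser fract)" for f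
    using assms by (simp add: prod.inter_restrict[symmetric] Int_absorb1)
  have inner: "(\<Prod>j\<in>K. if i \<in> D then f j else 1) = (if i \<in> D then (\<Prod>j\<in>K. f j) else (1 :: pser fract))" for i f
    by simp
  have "prefactor K (m + units D) =
      prefactor K m * (\<Prod>i\<in>K. \<Prod>j\<in>K. if j \<in> D then ?if i j (?X i j powi ?m i) else 1) *
      (\<Prod>i\<in>K. \<Prod>j\<in>K. if i \<in> D then ?if i j (?X i j powi ?m j) else 1) *
      (\<Prod>i\<in>K. \<Prod>j\<in>K. if i \<in> D then if j \<in> D then ?if i j (?X i j) else 1 else 1)"
    unfolding prefactor_def split prod.distrib ..
  also have "(\<Prod>i\<in>K. \<Prod>j\<in>K. if j \<in> D then ?if i j (?X i j powi ?m i) else 1) =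
      (\<Prod>l\<in>D. \<Prod>i\<in>K. ?if i l (?X i l powi ?m i))"
    by (subst prod.swap) (simp only: inner restrict)
  also have "(\<Prod>i\<in>K. \<Prod>j\<in>K. if i \<in> D then ?if i j (?X i j powi ?m j) else 1) =
      (\<Prod>l\<in>D. \<Prod>j\<in>K. ?if l j (?X l j powi ?m j))"
    by (simp only: inner restrict)
  also have "(\<Prod>i\<in>K. \<Prod>j\<in>K. if i \<in> D then if j \<in> D then ?if i j (?X i j) else 1 else 1) =
      (\<Prod>i\<in>D. \<Prod>j\<in>D. ?if i j (?X i j))"
    by (simp only: inner restrict)
  finally show ?thesis
    unfolding gauge_def prod.distrib by (simp only: mult.assoc)
qed

text \<open>For a list with a repetition both sides vanish, the left by the sign and the right by a
  Vandermonde factor. Otherwise the prefactor gives the Vandermonde product in increasing order, and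
  the sign turns it into the order of \<open>L\<close>.\<close>

lemma ptil_Hfun_lam:
  assumes "finite K" "Poly_Mapping.keys (n - units {- int k .. - 1}) \<subseteq> K" "set L \<subseteq> K"
    and "length L = k" "set L \<subseteq> {- int k..}"
  defines "m \<equiv> n - units {- int k .. - 1}"
  shows "ptil (Hfun_lam w n) L =
    prefactor K m * prod_list (map (gauge K m) L) * fr (vdm_tau w (ushift m) L)"
proof (cases "distinct L")
  case False
  have "xdiff x x = 0" for x by (simp add: xdiff_def)
  then have "vdm_tau w (ushift m) L = 0"
    unfolding vdm_tau_def using False by (simp add: pairprod_eq_0)
  then show ?thesis using False by (simp add: ptil_def sortsign_def)
next
  case True
  have "n + frob_shift (lam_of L) = m + units (set L)"
    unfolding frob_shift_lam_of[OF True assms(4,5)] m_def by simp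
  moreover have "Poly_Mapping.keys (m + units (set L)) \<subseteq> K"
  proof
    fix i assume i: "i \<in> Poly_Mapping.keys (m + units (set L))"
    show "i \<in> K"
    proof (cases "i \<in> set L")
      case True
      then show ?thesis using assms(3) by blast
    next
      case False
      then have "i \<in> Poly_Mapping.keys m" using i by (simp add: in_keys_iff lookup_add lookup_units)
      then show ?thesis using assms(2) unfolding m_def by blast
    qed
  qed
  ultimately have H: "Hfun_lam w n (lam_of L) =
      prefactor K m * (\<Prod>l\<in>set L. gauge K m l) *
      (\<Prod>i\<in>set L. \<Prod>j\<in>set L. if i < j then fr (xdiff i j) else 1) * fr (tau w (foldl addx (ushift m) L))"
    unfolding Hfun_lam_def
    by (simp only: Hfun_prefactor[OF assms(1)] prefactor_add_units[OF assms(1,3)] ushift_units[OF True])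
  have sorted: "(\<Prod>i\<in>set L. \<Prod>j\<in>set L. if i < j then fr (xdiff i j) else 1) = pairprod (\<lambda>i j. fr (xdiff i j)) (sort L)"
    using pairprod_sorted[of "sort L" "\<lambda>i j. fr (xdiff i j)"] True by simp
  have anti: "fr (xdiff i j) = - fr (xdiff j i)" for i j
    by (simp add: xdiff_xz flip: fr_uminus)
  have vdm: "of_int (sortsign L) * pairprod (\<lambda>i j. fr (xdiff i j)) (sort L) = fr (pairprod xdiff L)"
    using sortsign_mult_pairprod_sort[of "\<lambda>i j. fr (xdiff i j)", OF anti True] by (simp add: fr_pairprod)
  show ?thesis
    unfolding ptil_def H sorted vdm_tau_def fr_mult vdm[symmetric]
    using True by (simp add: prod.distinct_set_conv_list mult_ac)
qed

lemma Hfun_lam_pluecker: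
  assumes "is_grpoint w" "0 < k" "length I = k - 1" "length J = k + 1"
    "set I \<union> set J \<subseteq> {- int k ..}"
  shows "pluecker_form (Hfun_lam w n) I J = 0"
proof -
  obtain m where k: "k = Suc m" using assms(2) by (cases k) auto
  define n' where "n' = n - units {- int k .. - 1}"
  define K where "K = Poly_Mapping.keys n' \<union> set I \<union> set J"
  define u where "u = ushift n'"
  define C where "C = prefactor K n'"
  define g where "g L = prod_list (map (gauge K n') L)" for L
  have ptil: "ptil (Hfun_lam w n) L = C * g L * fr (vdm_tau w u L)"
    if "length L = k" "set L \<subseteq> set I \<union> set J" for L
    unfolding C_def g_def u_def n'_def
    by (rule ptil_Hfun_lam) (use that assms(5) in \<open>auto simp: K_def n'_def\<close>)
  have term_eq: "ptil (Hfun_lam w n) (I @ [J ! j]) * ptil (Hfun_lam w n) (take j J @ drop (Suc j) J) =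
      (C * C * g I * g J) * fr (vdm_tau w u (I @ [J ! j]) * vdm_tau w u (take j J @ drop (Suc j) J))"
    if "j < length J" for j
  proof -
    \<comment> \<open>Each term distributes the entries of \<open>I\<close> and \<open>J\<close>
      over two lists, so the product of their gauge factors is the same for all
      \<open>j\<close>.\<close>
    have "g J = g (take j J @ J ! j # drop (Suc j) J)" using id_take_nth_drop[OF that] by simp
    then have g: "g (I @ [J ! j]) * g (take j J @ drop (Suc j) J) = g I * g J" by (simp add: g_def mult_ac)
    have "ptil (Hfun_lam w n) (I @ [J ! j]) = C * g (I @ [J ! j]) * fr (vdm_tau w u (I @ [J ! j]))"
      using that assms(2,3) by (intro ptil) auto
    moreover have "ptil (Hfun_lam w n) (take j J @ drop (Suc j) J) =
        C * g (take j J @ drop (Suc j) J) * fr (vdm_tau w u (take j J @ drop (Suc j) J))"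
      using that assms(4) by (intro ptil) (auto dest: in_set_takeD in_set_dropD)
    ultimately have "ptil (Hfun_lam w n) (I @ [J ! j]) * ptil (Hfun_lam w n) (take j J @ drop (Suc j) J) =
        C * C * (g (I @ [J ! j]) * g (take j J @ drop (Suc j) J)) *
        (fr (vdm_tau w u (I @ [J ! j])) * fr (vdm_tau w u (take j J @ drop (Suc j) J)))"
      by (simp only: mult_ac)
    then show ?thesis unfolding g fr_mult by (simp only: mult.assoc)
  qed
  have "(\<Sum>j<length J. (-1) ^ j * ptil (Hfun_lam w n) (I @ [J ! j]) * ptil (Hfun_lam w n) (take j J @ drop (Suc j) J)) =
      (C * C * g I * g J) * fr (\<Sum>j<Suc (Suc m). (-1) ^ j * vdm_tau w u (I @ [J ! j]) * vdm_tau w u (take j J @ drop (Suc j) J))"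
    unfolding fr_sum sum_distrib_left
  proof (rule sum.cong)
    show "{..<length J} = {..<Suc (Suc m)}" using assms(4) k by simp
    fix j assume "j \<in> {..<Suc (Suc m)}"
    then have j: "j < length J" using assms(4) k by simp
    show "(-1) ^ j * ptil (Hfun_lam w n) (I @ [J ! j]) * ptil (Hfun_lam w n) (take j J @ drop (Suc j) J) =
      (C * C * g I * g J) * fr ((-1) ^ j * vdm_tau w u (I @ [J ! j]) * vdm_tau w u (take j J @ drop (Suc j) J))"
      using arg_cong[OF term_eq[OF j], of "(*) ((-1) ^ j)"] by (simp only: fr_mult fr_sign mult_ac)
  qed
  also have "\<dots> = 0"
    using tau_bilinear[OF assms(1), of I m J u] assms(3,4) k by (simp del: sum.lessThan_Suc)
  finally show ?thesis unfolding pluecker_form_alt by simp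
qed

text \<open>The induced map on the quotient is expressed by constancy on cosets of
  \<open>pluecker_ideal\<close>. Since \<open>Phi\<close> respects sums and products, vanishing on
  the ideal reduces to the generators.\<close>

theorem mainTheorem5:
  fixes w :: "partition \<Rightarrow> complex" and n :: "int \<Rightarrow>\<^sub>0 int"
  assumes "is_grpoint w"
  shows "(\<forall>q. Phi w n q \<in> Loc)
       \<and> Phi w n 1 = 1
       \<and> (\<forall>p q. Phi w n (p + q) = Phi w n p + Phi w n q)
       \<and> (\<forall>p q. Phi w n (p * q) = Phi w n p * Phi w n q)
       \<and> (\<forall>la. Phi w n (svar la) = Hfun_lam w n la)
       \<and> (\<forall>q\<in>pluecker_ideal. Phi w n q = 0)
       \<and> (\<forall>p q. p - q \<in> pluecker_ideal \<longrightarrow> Phi w n p = Phi w n q)"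
proof -
  interpret coeff_hom "\<lambda>c. Fract (fps_const (pconst c)) 1 :: pser fract"
    by unfold_locales (simp_all add: pconst_add pconst_mult Zero_fract_def One_fract_def
        flip: fps_const_add fps_const_mult)
  have ideal: "Phi w n q = 0" if "q \<in> pluecker_ideal" for q
    using that unfolding pluecker_ideal_def
  proof (induction rule: ideal_gen.induct)
    case (gen q)
    then obtain I J k N where q: "q = pluecker_form svar I J" and "0 < k" "length I = k - 1"
      "length J = k + 1" "set I \<union> set J \<subseteq> {- int k .. int N - int k - 1}"
      unfolding pluecker_gens_def by blast
    then have "pluecker_form (Hfun_lam w n) I J = 0"
      by (intro Hfun_lam_pluecker[OF assms, of k]) auto
    then show ?case unfolding q Phi_def seval_pluecker_form .
  qed (simp_all add: Phi_def seval_zero seval_add seval_mult)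
  have "Phi w n p = Phi w n q" if "p - q \<in> pluecker_ideal" for p q
  proof -
    have "Phi w n p = Phi w n (p - q) + Phi w n q"
      unfolding Phi_def by (simp flip: seval_add)
    then show ?thesis using ideal[OF that] by simp
  qed
  then show ?thesis
    using ideal Loc_Phi by (auto simp: Phi_def seval_one seval_add seval_mult seval_svar)
qed

end
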